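(* Let $G$ be a locally compact group with neutral element $e$ and let $f\in\mathcal{P}(\mathbb{S}^\infty,G)$ have the representation $$f(x,u)=\sum_{n=0}^\infty\varphi_n(u)x^n,\qquad (x,u)\in[-1,1]\times G,$$ where $\varphi_n\in\mathcal{P}(G)$ for $n\ge0$ and $\sum_{n=0}^\infty\varphi_n(e)<\infty$. Let $d\in\mathbb{N}$. Then the $d$-Schoenberg functions $\varphi_{n,d}$ in the representation of $f$, as an element of $\mathcal{P}(\mathbb{S}^d,G)$, as $$f(x,u)=\sum_{n=0}^\infty\varphi_{n,d}(u)c_n(d,x),\qquad (x,u)\in[-1,1]\times G,$$ are given, for $n\ge0$, by $$\varphi_{n,d}(u)=\sum_{j=0}^\infty\varphi_{n+2j}(u)\,\gamma^{(d)}(n+2j,j),\qquad u\in G,$$ and this series is uniformly convergent for $u\in G$. Here $$\gamma^{(d)}(n+2j,j)=\begin{cases}\dfrac{(n+2j)!\,(d-1)_n\,(n+(d-1)/2)}{n!\,2^{n+2j}\,j!\,((d-1)/2)_{n+j+1}} & \text{if } d\ge2,\\[2ex] \dfrac{\binom{n+2j}{j}}{2^{n+2j}}\,N_n(1) & \text{if } d=1,\end{cases}$$ where $N_0(1)=1$ and $N_n(1)=2$ for $n\ge1$.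
   Context: $\mathbb{N}=\{1,2,\ldots\}$. $(a)_n=a(a+1)\cdots(a+n-1)$ for $n\ge1$ and $(a)_0=1$. A function $\varphi:G\to\mathbb{C}$ is positive definite if for all $n\in\mathbb{N}$ and $u_1,\ldots,u_n\in G$ the matrix $[\varphi(u_k^{-1}u_l)]_{k,l=1}^n$ is (hermitian) positive semidefinite; $\mathcal{P}(G)$ is the set of continuous positive definite functions on $G$. For $d\in\mathbb{N}$, $\mathbb{S}^d$ is the unit sphere of $\mathbb{R}^{d+1}$ and $\xi\cdot\eta$ is the Euclidean scalar product. $\mathcal{P}(\mathbb{S}^d,G)$ is the set of continuous functions $f:[-1,1]\times G\to\mathbb{C}$ such that for all $n\in\mathbb{N}$ and all $(\xi_1,u_1),\ldots,(\xi_n,u_n)\in\mathbb{S}^d\times G$ the matrix $[f(\xi_k\cdot\xi_l,u_k^{-1}u_l)]_{k,l=1}^n$ is positive semidefinite, i.e. $\sum_{k,l=1}^n f(\xi_k\cdot\xi_l,u_k^{-1}u_l)a_k\overline{a_l}\ge 0$ for all $(a_1,\ldots,a_n)\in\mathbb{C}^n$. $\mathcal{P}(\mathbb{S}^\infty,G)=\bigcap_{d=1}^\infty\mathcal{P}(\mathbb{S}^d,G)$. Every $f\in\mathcal{P}(\mathbb{S}^\infty,G)$ has a (unique) power series representation of the kind in the claim. For $\lambda>0$ the Gegenbauer polynomials $C_n^{(\lambda)}$ are given by $(1-2xr+r^2)^{-\lambda}=\sum_{n=0}^\infty C_n^{(\lambda)}(x)r^n$, $|r|<1$; $c_n(d,x)=C_n^{((d-1)/2)}(x)/C_n^{((d-1)/2)}(1)$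 for $d\ge 2$, and $c_n(1,x)=T_n(x)=\cos(n\arccos x)$. For $f\in\mathcal{P}(\mathbb{S}^d,G)$ the $d$-Schoenberg functions of $f$ are the uniquely determined functions $\varphi_{n,d}\in\mathcal{P}(G)$, $n\ge0$, with $\sum_n\varphi_{n,d}(e)<\infty$ and $f(x,u)=\sum_{n=0}^\infty\varphi_{n,d}(u)c_n(d,x)$ (uniformly on $[-1,1]\times G$). Explicitly, $\varphi_{n,d}(u)=\frac{N_n(d)\sigma_{d-1}}{\sigma_d}\int_{-1}^1 f(x,u)c_n(d,x)(1-x^2)^{d/2-1}\,dx$, where $N_n(d)=\frac{(d)_{n-1}}{n!}(2n+d-1)$ for $n\ge1$, $N_0(d)=1$, $\sigma_d=\frac{2\pi^{(d+1)/2}}{\Gamma((d+1)/2)}$ and $\sigma_0=2$. *)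

theory Defs
  imports "HOL-Analysis.Analysis"
begin

text \<open>
  Groups are written additively, as in the class \<open>topological_group_add\<close>, which does not assume
  commutativity: \<open>0\<close> is the neutral element and \<open>- u + v\<close> stands for \<open>u\<^sup>-\<^sup>1 v\<close>.
\<close>

text \<open>
  A complex matrix with this property is automatically hermitian.  The set
  \<open>\<real>\<^sub>\<ge>\<^sub>0\<close> consists of the complex numbers that are real and nonnegative.
\<close>

definition pos_semidef :: "nat \<Rightarrow> (nat \<Rightarrow> nat \<Rightarrow> complex) \<Rightarrow> bool" where
  "pos_semidef n A \<longleftrightarrow>
     (\<forall>a :: nat \<Rightarrow> complex. (\<Sum>k<n. \<Sum>l<n. A k l * a k * cnj (a l)) \<in> \<real>\<^sub>\<ge>\<^sub>0)"

definition pos_def_funs :: "('g :: topological_group_add \<Rightarrow> complex) set" where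
  "pos_def_funs = {\<phi>. continuous_on UNIV \<phi> \<and>
     (\<forall>n \<ge> 1. \<forall>u :: nat \<Rightarrow> 'g. pos_semidef n (\<lambda>k l. \<phi> (- u k + u l)))}"

text \<open>
  The dimension \<open>d\<close> has to range over all natural numbers inside a formula, so \<open>\<real>\<^sup>d\<^sup>+\<^sup>1\<close> is modelled by
  the real sequences that vanish beyond index \<open>d\<close>.
\<close>

definition unit_sphere :: "nat \<Rightarrow> (nat \<Rightarrow> real) set" where
  "unit_sphere d = {\<xi>. (\<forall>i > d. \<xi> i = 0) \<and> (\<Sum>i\<le>d. (\<xi> i)\<^sup>2) = 1}"

definition scalar_product :: "nat \<Rightarrow> (nat \<Rightarrow> real) \<Rightarrow> (nat \<Rightarrow> real) \<Rightarrow> real" where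
  "scalar_product d \<xi> \<eta> = (\<Sum>i\<le>d. \<xi> i * \<eta> i)"

text \<open>
  Functions on \<open>[-1,1] \<times> G\<close> are total functions in HOL; only their values for \<open>x \<in> {-1..1}\<close> matter.
\<close>

definition sphere_pos_def_funs ::
    "nat \<Rightarrow> (real \<times> 'g :: topological_group_add \<Rightarrow> complex) set" where
  "sphere_pos_def_funs d = {f. continuous_on ({-1..1} \<times> UNIV) f \<and>
     (\<forall>n \<ge> 1. \<forall>\<xi> :: nat \<Rightarrow> nat \<Rightarrow> real. \<forall>u :: nat \<Rightarrow> 'g.
        (\<forall>k<n. \<xi> k \<in> unit_sphere d) \<longrightarrow>
        pos_semidef n (\<lambda>k l. f (scalar_product d (\<xi> k) (\<xi> l), - u k + u l)))}"

definition sphere_infinity_pos_def_funs ::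
    "(real \<times> 'g :: topological_group_add \<Rightarrow> complex) set" where
  "sphere_infinity_pos_def_funs = (\<Inter>d\<in>{1..}. sphere_pos_def_funs d)"

text \<open>
  The Gegenbauer polynomials are given by their generating function.  The definition
  is meaningful for \<open>\<alpha> > 0\<close> and \<open>\<bar>x\<bar> \<le> 1\<close>, where the base \<open>1 - 2 * x * r + r\<^sup>2\<close> is positive and its power
  has a power series expansion on \<open>\<bar>r\<bar> < 1\<close>; it is used only there.
\<close>

definition gegenbauer :: "real \<Rightarrow> nat \<Rightarrow> real \<Rightarrow> real" where
  "gegenbauer \<alpha> n x =
     (THE C. \<forall>r. \<bar>r\<bar> < 1 \<longrightarrow> (\<lambda>m. C m * r ^ m) sums ((1 - 2 * x * r + r\<^sup>2) powr (- \<alpha>))) n"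

definition normalized_gegenbauer :: "nat \<Rightarrow> nat \<Rightarrow> real \<Rightarrow> real" where
  "normalized_gegenbauer n d x =
     (if d = 1 then cos (real n * arccos x)
      else gegenbauer ((real d - 1) / 2) n x / gegenbauer ((real d - 1) / 2) n 1)"

definition schoenberg_representation ::
    "nat \<Rightarrow> (real \<times> 'g :: topological_group_add \<Rightarrow> complex) \<Rightarrow> (nat \<Rightarrow> 'g \<Rightarrow> complex) \<Rightarrow> bool" where
  "schoenberg_representation d f \<psi> \<longleftrightarrow>
     (\<forall>n. \<psi> n \<in> pos_def_funs) \<and>
     summable (\<lambda>n. \<psi> n 0) \<and>
     uniform_limit ({-1..1} \<times> UNIV)
       (\<lambda>N (x, u). \<Sum>n<N. \<psi> n u * of_real (normalized_gegenbauer n d x)) f sequentially"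

definition schoenberg_functions ::
    "nat \<Rightarrow> (real \<times> 'g :: topological_group_add \<Rightarrow> complex) \<Rightarrow> nat \<Rightarrow> 'g \<Rightarrow> complex" where
  "schoenberg_functions d f = (THE \<psi>. schoenberg_representation d f \<psi>)"

text \<open>
  \<open>schoenberg_gamma d n j\<close> is the coefficient \<open>\<gamma>\<^sup>(\<^sup>d\<^sup>)(n + 2j, j)\<close>.
\<close>

definition schoenberg_gamma :: "nat \<Rightarrow> nat \<Rightarrow> nat \<Rightarrow> real" where
  "schoenberg_gamma d n j =
     (if d = 1 then real ((n + 2 * j) choose j) / 2 ^ (n + 2 * j) * (if n = 0 then 1 else 2)
      else fact (n + 2 * j) * pochhammer (real d - 1) n * (real n + (real d - 1) / 2) /
           (fact n * 2 ^ (n + 2 * j) * fact j * pochhammer ((real d - 1) / 2) (n + j + 1)))"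

end

theory Submission
  imports Defs "HOL-Computational_Algebra.Formal_Power_Series"
begin

text \<open>
  Write \<open>c\<^sub>n\<close> for the normalized polynomials.  The recurrence of the Gegenbauer polynomials turns
  into a random walk: \<open>x c\<^sub>n = (1 - q\<^sub>n) c\<^sub>n\<^sub>+\<^sub>1 + q\<^sub>n c\<^sub>n\<^sub>-\<^sub>1\<close> with \<open>q\<^sub>n = n / (2n + d - 1)\<close>.  The numbers
  \<open>\<gamma>\<^sup>(\<^sup>d\<^sup>)(m, (m - n) / 2)\<close> are the probabilities that this walk, started at \<open>0\<close>, is in \<open>n\<close> after \<open>m\<close>
  steps; so they are nonnegative, add up to \<open>1\<close> and expand \<open>x\<^sup>m\<close> in the \<open>c\<^sub>n\<close>.  Since \<open>\<bar>c\<^sub>n\<bar> \<le> 1\<close> and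
  \<open>\<bar>\<phi>\<^sub>m(u)\<bar> \<le> \<phi>\<^sub>m(0)\<close>, the rearranged series differs from \<open>f\<close> after \<open>N\<close> terms by at most
  the sum of the \<open>\<phi>\<^sub>m(0)\<close> with \<open>m \<ge> N\<close>.  For uniqueness, the functional
  \<open>g \<mapsto> \<integral> g(cos t) sin\<^sup>d\<^sup>-\<^sup>1 t dt\<close> vanishes on \<open>c\<^sub>n\<close> for \<open>n \<ge> 1\<close>; by the walk it vanishes on \<open>x\<^sup>m c\<^sub>n\<close>
  for \<open>n > m\<close> but not for \<open>n = m\<close>, which determines the coefficients one after the other.
\<close>

unbundle no vec_syntax
unbundle fps_syntax

section \<open>Gegenbauer polynomials\<close>

text \<open>Once the lower coefficients are known to vanish, dividing by \<open>r ^ n\<close> for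
  \<open>r \<noteq> 0\<close> leaves a series with sum \<open>0\<close> that tends to
  \<open>a n\<close> as \<open>r\<close> tends to \<open>0\<close>.\<close>

lemma powser_sums_zero_imp_zero:
  fixes a :: "nat \<Rightarrow> real"
  assumes s: "0 < s" and sums: "\<And>r. \<bar>r\<bar> < s \<Longrightarrow> (\<lambda>n. a n * r ^ n) sums 0"
  shows "a n = 0"
proof (induction n rule: less_induct)
  case (less n)
  have "(\<lambda>k. a (k + n) * r ^ k) sums 0" if "r \<noteq> 0" "norm r < s" for r
  proof -
    have "(\<lambda>k. a (k + n) * r ^ (k + n)) sums 0"
      using sums[of r] that less.IH by (subst sums_iff_shift) auto
    then have "(\<lambda>k. r ^ n * (a (k + n) * r ^ k)) sums (r ^ n * 0)"
      by (simp add: power_add mult_ac)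
    then show ?thesis
      using that by (subst (asm) sums_mult_iff) auto
  qed
  then have "((\<lambda>_. 0) \<longlongrightarrow> a (0 + n)) (at (0 :: real))"
    by (rule powser_limit_0_strong[OF s])
  then show ?case
    by (simp add: tendsto_const_iff)
qed

section \<open>Factoring the generating function over the complex numbers\<close>

text \<open>If \<open>z\<close> lies on the unit circle and has real part \<open>x\<close>, then
  \<open>1 - 2 x r + r\<^sup>2 = (1 - r z) (1 - r cnj z)\<close>. These are the binomial
  coefficients in \<open>r\<close> of the first factor raised to the power
  \<open>-\<alpha>\<close>.\<close>

definition gegenbauer_factor :: "real \<Rightarrow> complex \<Rightarrow> nat \<Rightarrow> complex" where
  "gegenbauer_factor \<alpha> z k = of_real (pochhammer \<alpha> k / fact k) * z ^ k"

lemma gegenbauer_factor_sums: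
  assumes "norm z \<le> 1" "\<bar>r\<bar> < 1"
  shows "(\<lambda>k. gegenbauer_factor \<alpha> z k * of_real r ^ k) sums ((1 - of_real r * z) powr (- of_real \<alpha>))"
    and "summable (\<lambda>k. norm (gegenbauer_factor \<alpha> z k * of_real r ^ k))"
proof -
  have sums: "(\<lambda>k. gegenbauer_factor \<alpha> z k * of_real r ^ k) sums ((1 - of_real r * z) powr (- of_real \<alpha>))"
    if "\<bar>r\<bar> < 1" for r :: real
  proof -
    have "norm (of_real r * z) < 1"
      using assms(1) that by (simp add: norm_mult) (meson abs_ge_zero mult_left_le order_le_less_trans)
    then have "(\<lambda>k. ((- complex_of_real \<alpha>) gchoose k) * (- (of_real r * z)) ^ k) sums
        ((1 + (- (of_real r * z))) powr (- of_real \<alpha>))"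
      by (intro gen_binomial_complex) simp
    moreover have "gegenbauer_factor \<alpha> z k * of_real r ^ k =
      ((- complex_of_real \<alpha>) gchoose k) * (- (of_real r * z)) ^ k" for k
    proof -
      have "pochhammer (complex_of_real \<alpha>) k = of_real (pochhammer \<alpha> k)"
        by (simp add: pochhammer_of_real)
      then show ?thesis
        by (simp add: gegenbauer_factor_def gbinomial_pochhammer power_mult_distrib
            power_minus[of "of_real r * z"])
    qed
    ultimately show ?thesis
      by simp
  qed
  then show "(\<lambda>k. gegenbauer_factor \<alpha> z k * of_real r ^ k) sums ((1 - of_real r * z) powr (- of_real \<alpha>))"
    using assms by blast
  \<comment> \<open>Convergence at a point \<open>s\<close> beyond \<open>\<bar>r\<bar>\<close>
    gives absolute convergence at \<open>r\<close>, which the Cauchy product requires.\<close>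
  obtain s where s: "\<bar>r\<bar> < s" "s < 1"
    using assms dense by blast
  have "summable (\<lambda>k. gegenbauer_factor \<alpha> z k * of_real s ^ k)"
    using sums[of s] s by (auto simp: sums_iff)
  then show "summable (\<lambda>k. norm (gegenbauer_factor \<alpha> z k * of_real r ^ k))"
    by (rule powser_insidea) (use s in auto)
qed

definition gegenbauer_coeff :: "real \<Rightarrow> complex \<Rightarrow> nat \<Rightarrow> complex" where
  "gegenbauer_coeff \<alpha> z n =
     (\<Sum>i\<le>n. gegenbauer_factor \<alpha> z i * gegenbauer_factor \<alpha> (cnj z) (n - i))"

text \<open>The powers of the two factors are conjugate to each other, so their product is the
  squared modulus of one of them; and \<open>norm (1 - r z)\<close> squared is the quadratic in
  \<open>r\<close>. The left side is the Cauchy product of the two binomial series.\<close>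

lemma gegenbauer_coeff_sums:
  assumes z: "norm z = 1" and r: "\<bar>r\<bar> < 1"
  shows "(\<lambda>n. gegenbauer_coeff \<alpha> z n * of_real r ^ n) sums
           of_real ((1 - 2 * Re z * r + r\<^sup>2) powr (- \<alpha>))"
proof -
  let ?w = "1 - of_real r * z"
  have "norm (of_real r * z) < 1"
    using z r by (simp add: norm_mult)
  then have "Re (of_real r * z) < 1"
    using complex_Re_le_cmod le_less_trans by blast
  \<comment> \<open>This keeps \<open>?w\<close> off the branch cut of \<open>powr\<close>, so that
    the power commutes with conjugation.\<close>
  then have "Re ?w > 0"
    by simp
  then have cnj: "cnj (?w powr (- of_real \<alpha>)) = (1 - of_real r * cnj z) powr (- of_real \<alpha>)"
    by (subst cnj_powr) auto
  have "?w powr (- of_real \<alpha>) * (1 - of_real r * cnj z) powr (- of_real \<alpha>) =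
      of_real ((norm (?w powr (- of_real \<alpha>)))\<^sup>2)"
    by (simp only: complex_norm_square flip: cnj)
  also have "norm (?w powr (- of_real \<alpha>)) = norm ?w powr (- \<alpha>)"
    by (subst norm_powr_real_powr') auto
  also have "(norm ?w powr (- \<alpha>))\<^sup>2 = ((norm ?w)\<^sup>2) powr (- \<alpha>)"
    by (simp add: power2_eq_square powr_mult)
  also have "(norm ?w)\<^sup>2 = 1 - 2 * Re z * r + r\<^sup>2"
  proof -
    have "(Re z)\<^sup>2 + (Im z)\<^sup>2 = 1"
      using z by (simp add: cmod_def)
    then have "r\<^sup>2 * ((Re z)\<^sup>2 + (Im z)\<^sup>2) = r\<^sup>2"
      by simp
    then show ?thesis
      unfolding cmod_power2 by (simp add: power2_eq_square algebra_simps)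
  qed
  finally have eq: "?w powr (- of_real \<alpha>) * (1 - of_real r * cnj z) powr (- of_real \<alpha>) =
      of_real ((1 - 2 * Re z * r + r\<^sup>2) powr (- \<alpha>))" .
  have "(\<lambda>n. \<Sum>i\<le>n. (gegenbauer_factor \<alpha> z i * of_real r ^ i) *
        (gegenbauer_factor \<alpha> (cnj z) (n - i) * of_real r ^ (n - i))) sums
      ((\<Sum>k. gegenbauer_factor \<alpha> z k * of_real r ^ k) *
       (\<Sum>k. gegenbauer_factor \<alpha> (cnj z) k * of_real r ^ k))"
    by (intro Cauchy_product_sums gegenbauer_factor_sums) (use z r in auto)
  also have "(\<Sum>k. gegenbauer_factor \<alpha> z k * of_real r ^ k) = ?w powr (- of_real \<alpha>)"
    using gegenbauer_factor_sums(1)[of z r \<alpha>] z r by (simp add: sums_iff)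
  also have "(\<Sum>k. gegenbauer_factor \<alpha> (cnj z) k * of_real r ^ k) =
      (1 - of_real r * cnj z) powr (- of_real \<alpha>)"
    using gegenbauer_factor_sums(1)[of "cnj z" r \<alpha>] z r by (simp add: sums_iff)
  also have "(\<lambda>n. \<Sum>i\<le>n. (gegenbauer_factor \<alpha> z i * of_real r ^ i) *
        (gegenbauer_factor \<alpha> (cnj z) (n - i) * of_real r ^ (n - i))) =
      (\<lambda>n. gegenbauer_coeff \<alpha> z n * of_real r ^ n)"
  proof (intro ext)
    fix n
    have reord: "(a * of_real r ^ i) * (b * of_real r ^ (n - i)) = a * b * of_real r ^ n"
      if "i \<le> n" for i and a b :: complex
    proof -
      have "(a * of_real r ^ i) * (b * of_real r ^ (n - i)) = a * b * of_real r ^ (i + (n - i))"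
        by (simp only: power_add mult_ac)
      then show ?thesis
        using that by simp
    qed
    show "(\<Sum>i\<le>n. (gegenbauer_factor \<alpha> z i * of_real r ^ i) *
        (gegenbauer_factor \<alpha> (cnj z) (n - i) * of_real r ^ (n - i))) =
      gegenbauer_coeff \<alpha> z n * of_real r ^ n"
      unfolding gegenbauer_coeff_def sum_distrib_right
      by (intro sum.cong refl) (rule reord, simp)
  qed
  finally show ?thesis
    unfolding eq .
qed

text \<open>The recurrence is the coefficientwise form of
  \<open>(1 - 2 x r + r\<^sup>2) F' = 2 \<alpha> (x - r) F\<close>, where \<open>F\<close> is the generating function and \<open>x = Re z\<close>.\<close>

lemma gegenbauer_coeff_recurrence:
  assumes z: "norm z = 1"
  shows "of_nat (n + 2) * gegenbauer_coeff \<alpha> z (n + 2) =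
    of_real (2 * Re z * (real n + 1 + \<alpha>)) * gegenbauer_coeff \<alpha> z (n + 1)
      - of_real (real n + 2 * \<alpha>) * gegenbauer_coeff \<alpha> z n"
    and "gegenbauer_coeff \<alpha> z 1 = of_real (2 * Re z * \<alpha>)"
    and "gegenbauer_coeff \<alpha> z 0 = 1"
proof -
  show "gegenbauer_coeff \<alpha> z 0 = 1"
    by (simp add: gegenbauer_coeff_def gegenbauer_factor_def)
  show "gegenbauer_coeff \<alpha> z 1 = of_real (2 * Re z * \<alpha>)"
    by (simp add: gegenbauer_coeff_def gegenbauer_factor_def complex_eq_iff)
  define A where "A = (\<lambda>w. Abs_fps (gegenbauer_factor \<alpha> w))"
  define P where "P = A z * A (cnj z)"
  have P_nth: "P $ n = gegenbauer_coeff \<alpha> z n" for n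
    by (simp add: P_def A_def gegenbauer_coeff_def fps_mult_nth atMost_atLeast0)
  \<comment> \<open>The formal differential equation of a single factor \<open>(1 - w r)\<close> to
    the power \<open>-\<alpha>\<close>.\<close>
  have A: "(1 - fps_const w * fps_X) * fps_deriv (A w) = fps_const (of_real \<alpha> * w) * A w" for w
  proof (rule fps_ext)
    fix k
    have fac: "of_nat (Suc k) * gegenbauer_factor \<alpha> w (Suc k) =
        of_real (\<alpha> + k) * w * gegenbauer_factor \<alpha> w k" for k
      by (simp add: gegenbauer_factor_def pochhammer_Suc field_simps del: of_nat_Suc)
    have "((1 - fps_const w * fps_X) * fps_deriv (A w)) $ k =
        of_nat (Suc k) * gegenbauer_factor \<alpha> w (Suc k) - w * (of_nat k * gegenbauer_factor \<alpha> w k)"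
      by (cases k) (simp_all add: A_def left_diff_distrib mult.assoc del: of_nat_Suc)
    also have "\<dots> = (fps_const (of_real \<alpha> * w) * A w) $ k"
      unfolding fac by (simp add: A_def algebra_simps)
    finally show "((1 - fps_const w * fps_X) * fps_deriv (A w)) $ k =
        (fps_const (of_real \<alpha> * w) * A w) $ k" .
  qed
  have zz: "z * cnj z = 1" "z + cnj z = of_real (2 * Re z)"
    using z complex_norm_square[of z] complex_add_cnj by auto
  let ?x = "fps_const (of_real (2 * Re z)) :: complex fps"
  define a b where "a = fps_const z" and "b = fps_const (cnj z)"
  have x: "?x = a + b" and ab: "a * b = 1"
    using zz by (simp_all add: a_def b_def)
  \<comment> \<open>Writing the coefficient \<open>1\<close> of the square as \<open>a * b\<close>
    splits the quadratic into \<open>(1 - a X) (1 - b X)\<close>. In each summand of the product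
    rule one factor meets the derivative it belongs to.\<close>
  have "(1 - ?x * fps_X + fps_X * fps_X) * fps_deriv P =
    (1 - (a + b) * fps_X + (a * b) * (fps_X * fps_X)) * fps_deriv P"
    unfolding x ab by simp
  also have "\<dots> = ((1 - a * fps_X) * fps_deriv (A z)) * ((1 - b * fps_X) * A (cnj z))
     + ((1 - b * fps_X) * fps_deriv (A (cnj z))) * ((1 - a * fps_X) * A z)"
    by (simp add: P_def fps_deriv_mult algebra_simps)
  also have "\<dots> = (fps_const (of_real \<alpha>) * a * A z) * ((1 - b * fps_X) * A (cnj z))
     + (fps_const (of_real \<alpha>) * b * A (cnj z)) * ((1 - a * fps_X) * A z)"
    using A[of z] A[of "cnj z"] by (simp add: a_def b_def)
  also have "\<dots> = fps_const (of_real \<alpha>) * (a + b - 2 * (a * b) * fps_X) * P"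
    by (simp add: P_def algebra_simps)
  also have "\<dots> = fps_const (of_real \<alpha>) * (?x - 2 * fps_X) * P"
    unfolding x ab by simp
  finally have ode: "(1 - ?x * fps_X + fps_X * fps_X) * fps_deriv P =
      fps_const (of_real \<alpha>) * (?x - 2 * fps_X) * P" .
  have "((1 - ?x * fps_X + fps_X * fps_X) * fps_deriv P) $ Suc n =
      of_nat (n + 2) * P $ (n + 2) - of_real (2 * Re z) * (of_nat (n + 1) * P $ (n + 1)) + of_nat n * P $ n"
    by (cases n) (auto simp: algebra_simps numeral_2_eq_2)
  moreover have "(fps_const (of_real \<alpha>) * (?x - 2 * fps_X) * P) $ Suc n =
      of_real \<alpha> * (of_real (2 * Re z) * P $ (n + 1) - 2 * P $ n)"
    by (simp add: algebra_simps numeral_fps_const mult.assoc)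
  ultimately have "of_nat (n + 2) * P $ (n + 2) - of_real (2 * Re z) * (of_nat (n + 1) * P $ (n + 1)) +
      of_nat n * P $ n = of_real \<alpha> * (of_real (2 * Re z) * P $ (n + 1) - 2 * P $ n)"
    using ode by metis
  then show "of_nat (n + 2) * gegenbauer_coeff \<alpha> z (n + 2) =
    of_real (2 * Re z * (real n + 1 + \<alpha>)) * gegenbauer_coeff \<alpha> z (n + 1)
      - of_real (real n + 2 * \<alpha>) * gegenbauer_coeff \<alpha> z n"
    unfolding P_nth by (simp add: algebra_simps)
qed

text \<open>Uniqueness of power series coefficients makes the definite description in
  \<open>gegenbauer\<close> meaningful; \<open>cis (arccos x)\<close> is a point of the unit circle
  with real part \<open>x\<close>.\<close>

lemma gegenbauer_eq_coeff:
  assumes "\<bar>x\<bar> \<le> 1"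
  shows "gegenbauer \<alpha> n x = Re (gegenbauer_coeff \<alpha> (cis (arccos x)) n)"
proof -
  define C where "C = (\<lambda>n. Re (gegenbauer_coeff \<alpha> (cis (arccos x)) n))"
  have C: "(\<lambda>m. C m * r ^ m) sums ((1 - 2 * x * r + r\<^sup>2) powr (- \<alpha>))" if "\<bar>r\<bar> < 1" for r
    using sums_Re[OF gegenbauer_coeff_sums[of "cis (arccos x)" r \<alpha>]] assms that
    by (simp add: C_def cos_arccos_abs flip: of_real_power)
  have "(THE C. \<forall>r. \<bar>r\<bar> < 1 \<longrightarrow> (\<lambda>m. C m * r ^ m) sums ((1 - 2 * x * r + r\<^sup>2) powr (- \<alpha>))) = C"
  proof (rule the_equality)
    fix D assume D: "\<forall>r. \<bar>r\<bar> < 1 \<longrightarrow> (\<lambda>m. D m * r ^ m) sums ((1 - 2 * x * r + r\<^sup>2) powr (- \<alpha>))"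
    have "(\<lambda>m. (D m - C m) * r ^ m) sums 0" if "\<bar>r\<bar> < 1" for r
      using sums_diff[OF D[rule_format, OF that] C[OF that]] by (simp add: algebra_simps)
    then have "D m - C m = 0" for m
      by (rule powser_sums_zero_imp_zero[of 1, rotated]) auto
    then show "D = C"
      by (simp add: fun_eq_iff)
  qed (use C in blast)
  then show ?thesis
    by (simp add: gegenbauer_def C_def)
qed

lemma gegenbauer_recurrence:
  assumes "\<bar>x\<bar> \<le> 1"
  shows "real (n + 2) * gegenbauer \<alpha> (n + 2) x =
      2 * x * (real n + 1 + \<alpha>) * gegenbauer \<alpha> (n + 1) x - (real n + 2 * \<alpha>) * gegenbauer \<alpha> n x"
    and "gegenbauer \<alpha> 1 x = 2 * x * \<alpha>"
    and "gegenbauer \<alpha> 0 x = 1"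
proof -
  let ?z = "cis (arccos x)"
  have Re: "Re ?z = x"
    using assms by (simp add: cos_arccos_abs)
  show "gegenbauer \<alpha> 1 x = 2 * x * \<alpha>" "gegenbauer \<alpha> 0 x = 1"
    using assms gegenbauer_coeff_recurrence(2,3)[of ?z \<alpha>] by (simp_all add: gegenbauer_eq_coeff Re)
  have "Re (of_real (real (n + 2)) * gegenbauer_coeff \<alpha> ?z (n + 2)) =
      Re (of_real (2 * Re ?z * (real n + 1 + \<alpha>)) * gegenbauer_coeff \<alpha> ?z (n + 1)
      - of_real (real n + 2 * \<alpha>) * gegenbauer_coeff \<alpha> ?z n)"
    using gegenbauer_coeff_recurrence(1)[of ?z n \<alpha>] by (simp only: of_real_of_nat_eq norm_cis)
  moreover have "Re (of_real a * w) = a * Re w" for a w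
    by simp
  ultimately show "real (n + 2) * gegenbauer \<alpha> (n + 2) x =
      2 * x * (real n + 1 + \<alpha>) * gegenbauer \<alpha> (n + 1) x - (real n + 2 * \<alpha>) * gegenbauer \<alpha> n x"
    using assms by (simp only: minus_complex.sel gegenbauer_eq_coeff Re)
qed

section \<open>The value at 1 as the maximum modulus\<close>

text \<open>At \<open>x = 1\<close> the three-term recurrence collapses to first order: the
  induction hypothesis turns its last term into a multiple of the middle one. This gives the ratios
  of the normalizing denominators.\<close>

lemma gegenbauer_at_1:
  "real (Suc n) * gegenbauer \<alpha> (Suc n) 1 = (real n + 2 * \<alpha>) * gegenbauer \<alpha> n 1"
proof (induction n)
  case 0
  then show ?case
    using gegenbauer_recurrence(2,3)[of 1 \<alpha>] by simp
next
  case (Suc n)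
  then show ?case
    using gegenbauer_recurrence(1)[of 1 n \<alpha>] by (simp add: algebra_simps)
qed

lemma gegenbauer_at_1_pos: "\<alpha> > 0 \<Longrightarrow> gegenbauer \<alpha> n 1 > 0"
proof (induction n)
  case 0
  then show ?case
    using gegenbauer_recurrence(3)[of 1 \<alpha>] by simp
next
  case (Suc n)
  then have "real (Suc n) * gegenbauer \<alpha> (Suc n) 1 > 0"
    unfolding gegenbauer_at_1 by simp
  then show ?case
    by (simp add: zero_less_mult_iff)
qed

text \<open>For \<open>\<alpha> > 0\<close> the moduli of the summands in
  \<open>gegenbauer_coeff\<close> do not depend on the point of the unit circle, and at
  \<open>z = 1\<close> the summands equal their moduli. So the triangle inequality bounds by the
  value at \<open>1\<close>.\<close>

lemma abs_gegenbauer_le: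
  assumes "\<bar>x\<bar> \<le> 1" "\<alpha> > 0"
  shows "\<bar>gegenbauer \<alpha> n x\<bar> \<le> gegenbauer \<alpha> n 1"
proof -
  have norm: "norm (gegenbauer_factor \<alpha> z k) = pochhammer \<alpha> k / fact k" if "norm z = 1" for z k
    using assms that unfolding gegenbauer_factor_def norm_mult norm_of_real norm_power
    by (simp add: pochhammer_nonneg)
  have "\<bar>gegenbauer \<alpha> n x\<bar> \<le> norm (gegenbauer_coeff \<alpha> (cis (arccos x)) n)"
    using assms abs_Re_le_cmod by (simp add: gegenbauer_eq_coeff)
  also have "\<dots> \<le> (\<Sum>i\<le>n. norm (gegenbauer_factor \<alpha> (cis (arccos x)) i *
      gegenbauer_factor \<alpha> (cnj (cis (arccos x))) (n - i)))"
    unfolding gegenbauer_coeff_def by (rule norm_sum)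
  also have "\<dots> = (\<Sum>i\<le>n. pochhammer \<alpha> i / fact i * (pochhammer \<alpha> (n - i) / fact (n - i)))"
    by (simp add: norm_mult norm)
  also have "\<dots> = gegenbauer \<alpha> n 1"
  proof -
    have "gegenbauer_coeff \<alpha> 1 n =
        of_real (\<Sum>i\<le>n. pochhammer \<alpha> i / fact i * (pochhammer \<alpha> (n - i) / fact (n - i)))"
      by (simp add: gegenbauer_coeff_def gegenbauer_factor_def)
    then have "Re (gegenbauer_coeff \<alpha> 1 n) =
        (\<Sum>i\<le>n. pochhammer \<alpha> i / fact i * (pochhammer \<alpha> (n - i) / fact (n - i)))"
      by (simp only: Re_complex_of_real)
    then show ?thesis
      by (simp add: gegenbauer_eq_coeff)
  qed
  finally show ?thesis .
qed

section \<open>Expansion of powers\<close>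

lemma normalized_gegenbauer_0 [simp]: "\<bar>x\<bar> \<le> 1 \<Longrightarrow> normalized_gegenbauer 0 d x = 1"
  by (simp add: normalized_gegenbauer_def gegenbauer_recurrence(3))

lemma normalized_gegenbauer_at_1:
  assumes "d \<ge> 1"
  shows "normalized_gegenbauer n d 1 = 1"
  using assms gegenbauer_at_1_pos[of "(real d - 1) / 2" n]
  by (cases "d = 1") (auto simp: normalized_gegenbauer_def)

lemma abs_normalized_gegenbauer_le_1:
  assumes "d \<ge> 1" "\<bar>x\<bar> \<le> 1"
  shows "\<bar>normalized_gegenbauer n d x\<bar> \<le> 1"
  using assms gegenbauer_at_1_pos[of "(real d - 1) / 2" n] abs_gegenbauer_le[of x "(real d - 1) / 2" n]
  by (cases "d = 1") (auto simp: normalized_gegenbauer_def)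

text \<open>For \<open>d = 1\<close> and \<open>n = 0\<close> this is \<open>0 / 0 = 0\<close>, the value required by
  \<open>gegenbauer_walk\<close> below.\<close>

definition down_weight :: "nat \<Rightarrow> nat \<Rightarrow> real" where
  "down_weight d n = real n / (2 * real n + real d - 1)"

lemma down_weight_0 [simp]: "down_weight d 0 = 0"
  by (simp add: down_weight_def)

lemma down_weight_pos: "d \<ge> 1 \<Longrightarrow> n \<ge> 1 \<Longrightarrow> down_weight d n > 0"
  by (simp add: down_weight_def)

lemma down_weight_less_1: "d \<ge> 1 \<Longrightarrow> down_weight d n < 1"
  by (cases "n = 0") (auto simp: down_weight_def divide_less_eq)

text \<open>For \<open>d = 1\<close> this is the sum formula for cosines; otherwise it is the
  recurrence divided by the values at \<open>1\<close>. For \<open>n = 0\<close> the truncated index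
  \<open>n - 1\<close> is harmless because its weight is \<open>0\<close>.\<close>

lemma gegenbauer_walk:
  assumes d: "d \<ge> 1" and x: "\<bar>x\<bar> \<le> 1"
  shows "x * normalized_gegenbauer n d x =
    (1 - down_weight d n) * normalized_gegenbauer (n + 1) d x
      + down_weight d n * normalized_gegenbauer (n - 1) d x"
proof (cases "d = 1")
  case True
  define t where "t = arccos x"
  have xt: "x = cos t"
    using x by (simp add: t_def cos_arccos_abs)
  show ?thesis
  proof (cases n)
    case (Suc m)
    have "real (n + 1) * t = real n * t + t" "real (n - 1) * t = real n * t - t"
      by (simp_all add: Suc algebra_simps)
    then have "cos (real (n + 1) * t) + cos (real (n - 1) * t) = 2 * (cos t * cos (real n * t))"
      by (simp only: cos_add cos_diff) simp
    moreover have c: "normalized_gegenbauer k d x = cos (real k * t)" for k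
      by (simp add: normalized_gegenbauer_def True t_def)
    moreover have w: "down_weight d n = 1 / 2"
      by (simp add: True Suc down_weight_def field_simps)
    ultimately show ?thesis
      unfolding c w by (simp add: xt field_simps)
  qed (use True x in \<open>simp add: normalized_gegenbauer_def cos_arccos_abs\<close>)
next
  case False
  define \<alpha> where "\<alpha> = (real d - 1) / 2"
  have \<alpha>: "\<alpha> > 0" and d\<alpha>: "real d - 1 = 2 * \<alpha>"
    using d False by (auto simp: \<alpha>_def)
  have c: "normalized_gegenbauer n d x = gegenbauer \<alpha> n x / gegenbauer \<alpha> n 1" for n
    using False by (simp add: normalized_gegenbauer_def \<alpha>_def)
  have pos: "gegenbauer \<alpha> n 1 > 0" for n
    using \<alpha> by (rule gegenbauer_at_1_pos)
  have at1: "gegenbauer \<alpha> (Suc n) 1 = (real n + 2 * \<alpha>) * gegenbauer \<alpha> n 1 / real (Suc n)" for n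
    using gegenbauer_at_1[of n \<alpha>] by (simp add: field_simps)
  have q: "down_weight d n = real n / (2 * (real n + \<alpha>))" for n
    using d\<alpha> by (simp add: down_weight_def algebra_simps)
  show ?thesis
  proof (cases n)
    case 0
    then show ?thesis
      using x \<alpha> gegenbauer_recurrence(2,3)[of x \<alpha>] gegenbauer_recurrence(2,3)[of 1 \<alpha>] by (simp add: c)
  next
    case (Suc m)
    \<comment> \<open>In terms of \<open>X\<close>, \<open>Y\<close> and \<open>D\<close> all values
      at the indices \<open>m\<close>, \<open>m + 1\<close> and \<open>m + 2\<close> are explicit,
      and the claim becomes a rational identity.\<close>
    define X where "X = gegenbauer \<alpha> (m + 1) x"
    define Y where "Y = gegenbauer \<alpha> m x"
    define D where "D = gegenbauer \<alpha> m 1"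
    have D: "D > 0"
      using pos by (simp add: D_def)
    have Z: "gegenbauer \<alpha> (m + 2) x = (2 * x * (real m + 1 + \<alpha>) * X - (real m + 2 * \<alpha>) * Y) / real (m + 2)"
      using gegenbauer_recurrence(1)[OF x, of m \<alpha>] by (simp add: X_def Y_def field_simps)
    have D1: "gegenbauer \<alpha> (m + 1) 1 = (real m + 2 * \<alpha>) * D / (real m + 1)"
      and D2: "gegenbauer \<alpha> (m + 2) 1 =
        (real m + 1 + 2 * \<alpha>) * ((real m + 2 * \<alpha>) * D / (real m + 1)) / (real m + 2)"
      using at1[of m] at1[of "Suc m"] by (simp_all add: D_def algebra_simps)
    have p: "1 - down_weight d n = (real m + 1 + 2 * \<alpha>) / (2 * (real m + 1 + \<alpha>))"
      using \<alpha> by (simp add: q Suc field_simps)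
    have up: "(1 - down_weight d n) * normalized_gegenbauer (n + 1) d x =
        (2 * x * (real m + 1 + \<alpha>) * X - (real m + 2 * \<alpha>) * Y) * (real m + 1) /
        (2 * (real m + 1 + \<alpha>) * (real m + 2 * \<alpha>) * D)"
    proof -
      have c2: "normalized_gegenbauer (n + 1) d x = gegenbauer \<alpha> (m + 2) x / gegenbauer \<alpha> (m + 2) 1"
        by (simp add: c Suc)
      have "real m + 1 + 2 * \<alpha> > 0" "real m + 2 * \<alpha> > 0" "real m + 1 + \<alpha> > 0"
        using \<alpha> by auto
      then show ?thesis
        unfolding p c2 Z D2 using D by (simp add: divide_simps) 
    qed
    have down: "down_weight d n * normalized_gegenbauer (n - 1) d x =
        (real m + 1) / (2 * (real m + 1 + \<alpha>)) * (Y / D)"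
      by (simp add: c q Suc Y_def D_def algebra_simps)
    have mid: "x * normalized_gegenbauer n d x = x * (X * (real m + 1) / ((real m + 2 * \<alpha>) * D))"
      using D1 by (simp add: c Suc X_def)
    show ?thesis
      unfolding up down mid using \<alpha> D add_pos_pos[of "real m + 1" \<alpha>] add_nonneg_pos[of "real m" "2 * \<alpha>"]
      by (simp add: divide_simps) (simp add: algebra_simps)
  qed
qed

text \<open>The walk relation can be solved for its highest term, whose weight
  \<open>1 - down_weight d m\<close> is nonzero; this gives continuity by induction.\<close>

lemma continuous_on_normalized_gegenbauer:
  assumes d: "d \<ge> 1"
  shows "continuous_on {-1..1} (normalized_gegenbauer n d)"
proof (induction n rule: less_induct)
  case (less n)
  show ?case
  proof (cases n)
    case 0
    have "continuous_on {-1..1} (normalized_gegenbauer n d) \<longleftrightarrow> continuous_on {-1..1} (\<lambda>_ :: real. 1 :: real)"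
      by (rule continuous_on_cong) (auto simp: 0)
    then show ?thesis
      by simp
  next
    case (Suc m)
    have "continuous_on {-1..1} (\<lambda>x. (x * normalized_gegenbauer m d x
        - down_weight d m * normalized_gegenbauer (m - 1) d x) / (1 - down_weight d m))"
      using less.IH[of m] less.IH[of "m - 1"] Suc down_weight_less_1[OF d, of m]
      by (intro continuous_intros) auto
    moreover have "(x * normalized_gegenbauer m d x
        - down_weight d m * normalized_gegenbauer (m - 1) d x) / (1 - down_weight d m) =
        normalized_gegenbauer n d x" if "x \<in> {-1..1}" for x
      using gegenbauer_walk[OF d, of x m] that down_weight_less_1[OF d, of m] Suc
      by (simp add: abs_le_iff field_simps)
    ultimately show ?thesis
      by (rule continuous_on_eq)
  qed
qed

section \<open>The coefficients as transition probabilities\<close>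

text \<open>Indexed by the number \<open>m\<close> of steps and the state \<open>n\<close> reached.
  The test \<open>n \<le> m\<close> is explicit because \<open>m - n\<close> would otherwise
  truncate to the even number \<open>0\<close>.\<close>

definition schoenberg_coeff :: "nat \<Rightarrow> nat \<Rightarrow> nat \<Rightarrow> real" where
  "schoenberg_coeff d m n = (if n \<le> m \<and> even (m - n) then schoenberg_gamma d n ((m - n) div 2) else 0)"

lemma schoenberg_coeff_shift [simp]: "schoenberg_coeff d (n + 2 * j) n = schoenberg_gamma d n j"
  by (simp add: schoenberg_coeff_def)

lemma schoenberg_coeff_eq_0: "m < n \<Longrightarrow> schoenberg_coeff d m n = 0"
  by (simp add: schoenberg_coeff_def)

lemma schoenberg_gamma_nonneg: "d \<ge> 1 \<Longrightarrow> schoenberg_gamma d n j \<ge> 0"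
  unfolding schoenberg_gamma_def
  by (auto intro!: divide_nonneg_nonneg mult_nonneg_nonneg pochhammer_nonneg add_nonneg_nonneg)

lemma schoenberg_coeff_nonneg: "d \<ge> 1 \<Longrightarrow> schoenberg_coeff d m n \<ge> 0"
  by (simp add: schoenberg_coeff_def schoenberg_gamma_nonneg)

lemma schoenberg_gamma_0_0: "d \<ge> 1 \<Longrightarrow> schoenberg_gamma d 0 0 = 1"
  by (auto simp: schoenberg_gamma_def)

lemma schoenberg_gamma_eq:
  assumes "d \<ge> 1" "d \<noteq> 1" "\<alpha> = (real d - 1) / 2"
  shows "schoenberg_gamma d n j = fact (n + 2 * j) * pochhammer (2 * \<alpha>) n * (real n + \<alpha>) /
      (fact n * 2 ^ (n + 2 * j) * fact j * pochhammer \<alpha> (n + j + 1))"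
    and "down_weight d n = real n / (2 * (real n + \<alpha>))"
    and "\<alpha> > 0"
proof -
  have d: "real d - 1 = 2 * \<alpha>" "(real d - 1) / 2 = \<alpha>" "2 * real n + real d - 1 = 2 * (real n + \<alpha>)"
    using assms by auto
  show "schoenberg_gamma d n j = fact (n + 2 * j) * pochhammer (2 * \<alpha>) n * (real n + \<alpha>) /
      (fact n * 2 ^ (n + 2 * j) * fact j * pochhammer \<alpha> (n + j + 1))"
    by (simp only: schoenberg_gamma_def d(2) if_not_P[OF assms(2)]) (simp only: d(1))
  show "down_weight d n = real n / (2 * (real n + \<alpha>))"
    by (simp only: down_weight_def d)
  show "\<alpha> > 0"
    using assms by auto
qed

text \<open>The walk enters \<open>0\<close> only from \<open>1\<close>. This and the next two
  lemmas are its one-step equations: into \<open>0\<close>, along the diagonal where every step went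
  up, and in general from both neighbours.\<close>

lemma schoenberg_gamma_0_Suc:
  assumes "d \<ge> 1"
  shows "schoenberg_gamma d 0 (Suc j) = down_weight d 1 * schoenberg_gamma d 1 j"
proof (cases "d = 1")
  case True
  have "Suc (2 * j) choose Suc j = Suc (2 * j) choose j"
    by (subst binomial_symmetric) auto
  then show ?thesis
    using True by (simp add: schoenberg_gamma_def down_weight_def)
next
  case False
  define \<alpha> where "\<alpha> = (real d - 1) / 2"
  note eq = schoenberg_gamma_eq[OF assms False \<alpha>_def]
  have "pochhammer \<alpha> (j + 2) > 0"
    using eq(3) by (rule pochhammer_pos)
  then show ?thesis
    unfolding eq(1,2) using eq(3) by (simp add: divide_simps) (simp add: algebra_simps)
qed

lemma schoenberg_gamma_Suc_0:
  assumes "d \<ge> 1"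
  shows "schoenberg_gamma d (Suc n) 0 = (1 - down_weight d n) * schoenberg_gamma d n 0"
proof (cases "d = 1")
  case True
  then show ?thesis
    by (simp add: schoenberg_gamma_def down_weight_def)
next
  case False
  define \<alpha> where "\<alpha> = (real d - 1) / 2"
  note eq = schoenberg_gamma_eq[OF assms False \<alpha>_def]
  define P where "P = pochhammer \<alpha> (Suc n)"
  define Q where "Q = pochhammer (2 * \<alpha>) n"
  have pos: "P > 0" "real n + \<alpha> > 0" "real n + 1 + \<alpha> > 0"
    using eq(3) by (auto simp: P_def intro!: pochhammer_pos)
  have "schoenberg_gamma d (Suc n) 0 = Q * (2 * \<alpha> + real n) / (2 ^ Suc n * P)"
    using pos by (simp add: eq(1) P_def Q_def pochhammer_Suc[of _ n] pochhammer_Suc[of _ "Suc n"] add_ac)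
  also have "\<dots> = (real n + 2 * \<alpha>) / (2 * (real n + \<alpha>)) * (Q * (real n + \<alpha>) / (2 ^ n * P))"
    using pos by (simp add: divide_simps) (simp add: algebra_simps)
  also have "Q * (real n + \<alpha>) / (2 ^ n * P) = schoenberg_gamma d n 0"
    by (simp add: eq(1) P_def Q_def)
  also have "(real n + 2 * \<alpha>) / (2 * (real n + \<alpha>)) = 1 - down_weight d n"
    using eq(3) by (simp add: eq(2) field_simps)
  finally show ?thesis .
qed

text \<open>For \<open>d = 1\<close> this is Pascal's rule; otherwise all three terms are multiples
  of a common factor \<open>R\<close>, and a rational identity in \<open>\<alpha>\<close>,
  \<open>n\<close> and \<open>j\<close> remains.\<close>

lemma schoenberg_gamma_Suc_Suc:
  assumes "d \<ge> 1"
  shows "schoenberg_gamma d (Suc n) (Suc j) =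
    (1 - down_weight d n) * schoenberg_gamma d n (Suc j)
      + down_weight d (n + 2) * schoenberg_gamma d (n + 2) j"
proof (cases "d = 1")
  case True
  have "Suc n + 2 * Suc j choose Suc j = (n + 2 * Suc j choose Suc j) + (n + 2 + 2 * j choose j)"
    by simp
  \<comment> \<open>From \<open>0\<close> the walk goes up with probability \<open>1\<close> instead
    of \<open>1 / 2\<close>, which compensates for the factor in \<open>schoenberg_gamma\<close>
    that is \<open>1\<close> at \<open>n = 0\<close> and \<open>2\<close> afterwards.\<close>
  moreover have w: "down_weight 1 (n + 2) = 1 / 2" "1 - down_weight 1 n = (if n = 0 then 1 else 1 / 2)"
    by (auto simp: down_weight_def field_simps)
  ultimately show ?thesis
    unfolding schoenberg_gamma_def True w by (simp add: add_divide_distrib)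
next
  case False
  define \<alpha> where "\<alpha> = (real d - 1) / 2"
  note eq = schoenberg_gamma_eq[OF assms False \<alpha>_def]
  define M where "M = n + 2 * j + 2"
  define P where "P = pochhammer \<alpha> (n + j + 2)"
  define Q where "Q = pochhammer (2 * \<alpha>) n"
  define R where "R = fact M * Q / (fact n * 2 ^ (M + 1) * fact j * P)"
  have pos: "P > 0" "real n + \<alpha> > 0" "real n + 2 + \<alpha> > 0" "\<alpha> + real n + real j + 2 > 0"
    using eq(3) by (auto simp: P_def intro!: pochhammer_pos)
  have P: "pochhammer \<alpha> (n + j + 3) = P * (\<alpha> + real n + real j + 2)"
    by (simp add: P_def pochhammer_Suc numeral_3_eq_3 algebra_simps)
  have Q: "pochhammer (2 * \<alpha>) (Suc n) = Q * (2 * \<alpha> + real n)"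
    "pochhammer (2 * \<alpha>) (n + 2) = Q * (2 * \<alpha> + real n) * (2 * \<alpha> + real n + 1)"
    by (simp_all add: Q_def pochhammer_Suc algebra_simps)
  have "schoenberg_gamma d (Suc n) (Suc j) =
      fact (M + 1) * (Q * (2 * \<alpha> + real n)) * (real n + 1 + \<alpha>) /
      (fact (Suc n) * 2 ^ (M + 1) * fact (Suc j) * (P * (\<alpha> + real n + real j + 2)))"
    unfolding eq(1) Q(1) P[symmetric] by (simp add: M_def numeral_3_eq_3 algebra_simps)
  also have "\<dots> = R * ((real M + 1) * (2 * \<alpha> + real n) * (real n + 1 + \<alpha>) /
      ((real n + 1) * (real j + 1) * (\<alpha> + real n + real j + 2)))"
    by (simp add: R_def mult_ac add_ac)
  finally have L: "schoenberg_gamma d (Suc n) (Suc j) = R * ((real M + 1) * (2 * \<alpha> + real n) * (real n + 1 + \<alpha>) /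
      ((real n + 1) * (real j + 1) * (\<alpha> + real n + real j + 2)))" .
  have g1: "schoenberg_gamma d n (Suc j) = fact M * Q * (real n + \<alpha>) / (fact n * 2 ^ M * fact (Suc j) * P)"
    unfolding eq(1) by (simp add: M_def P_def Q_def)
  have w1: "1 - down_weight d n = (real n + 2 * \<alpha>) / (2 * (real n + \<alpha>))"
    using eq(3) by (simp add: eq(2) field_simps)
  have T1: "(1 - down_weight d n) * schoenberg_gamma d n (Suc j) = R * ((2 * \<alpha> + real n) / (real j + 1))"
    unfolding g1 w1 using pos by (simp add: R_def divide_simps) (simp add: algebra_simps)
  have g2: "schoenberg_gamma d (n + 2) j = fact M * (Q * (2 * \<alpha> + real n) * (2 * \<alpha> + real n + 1)) * (real n + 2 + \<alpha>) /
      ((real n + 2) * (real n + 1) * fact n * 2 ^ M * fact j * (P * (\<alpha> + real n + real j + 2)))"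
    unfolding eq(1) Q(2) P[symmetric] by (simp add: M_def numeral_3_eq_3 algebra_simps)
  have w2: "down_weight d (n + 2) = (real n + 2) / (2 * (real n + 2 + \<alpha>))"
    by (simp add: eq(2) algebra_simps)
  have T2: "down_weight d (n + 2) * schoenberg_gamma d (n + 2) j =
      R * ((2 * \<alpha> + real n) * (2 * \<alpha> + real n + 1) / ((real n + 1) * (\<alpha> + real n + real j + 2)))"
    unfolding g2 w2 using pos by (simp add: R_def divide_simps) (simp add: algebra_simps)
  \<comment> \<open>Up to the common factor \<open>2 \<alpha> + n\<close> and the denominators this
    says \<open>(M + 1) (n + 1 + \<alpha>) = (n + 1) (\<alpha> + n + j + 2) + (j + 1) (2 \<alpha> +
    n + 1)\<close> with \<open>M = n + 2 j + 2\<close>.\<close>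
  have "(real M + 1) * (2 * \<alpha> + real n) * (real n + 1 + \<alpha>) /
      ((real n + 1) * (real j + 1) * (\<alpha> + real n + real j + 2)) =
      (2 * \<alpha> + real n) / (real j + 1) +
      (2 * \<alpha> + real n) * (2 * \<alpha> + real n + 1) / ((real n + 1) * (\<alpha> + real n + real j + 2))"
    using pos by (simp add: divide_simps) (simp add: M_def algebra_simps)
  then show ?thesis
    unfolding L T1 T2 by (simp only: distrib_left)
qed

lemma schoenberg_coeff_0: "d \<ge> 1 \<Longrightarrow> schoenberg_coeff d 0 n = (if n = 0 then 1 else 0)"
  by (auto simp: schoenberg_coeff_def schoenberg_gamma_0_0)

lemma schoenberg_coeff_Suc_0:
  assumes "d \<ge> 1"
  shows "schoenberg_coeff d (Suc m) 0 = down_weight d 1 * schoenberg_coeff d m 1"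
proof (cases "even m")
  case False
  then obtain j where "m = 1 + 2 * j"
    by (auto elim!: oddE)
  then show ?thesis
    using schoenberg_gamma_0_Suc[OF assms, of j] schoenberg_coeff_shift[of d 0 "Suc j"]
      schoenberg_coeff_shift[of d 1 j] by simp
qed (auto simp: schoenberg_coeff_def)

lemma schoenberg_coeff_Suc_Suc:
  assumes "d \<ge> 1"
  shows "schoenberg_coeff d (Suc m) (Suc n) =
    (1 - down_weight d n) * schoenberg_coeff d m n + down_weight d (n + 2) * schoenberg_coeff d m (n + 2)"
proof -
  \<comment> \<open>In the first two cases every term is \<open>0\<close>, on the diagonal the state
    \<open>n + 2\<close> is out of reach, and the last case is
    \<open>schoenberg_gamma_Suc_Suc\<close>.\<close>
  consider "m < n" | "n \<le> m" "odd (m - n)" | "m = n" | j where "m = n + 2 * Suc j"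
  proof -
    have "\<exists>j. m = n + 2 * Suc j" if "n \<le> m" "even (m - n)" "m \<noteq> n"
      using that by (metis evenE le_add_diff_inverse not0_implies_Suc mult_0_right add_0_right)
    then show ?thesis
      using that by (meson not_le)
  qed
  then show ?thesis
  proof cases
    case 4
    have "m = (n + 2) + 2 * j" "Suc m = Suc n + 2 * Suc j"
      using 4 by auto
    then show ?thesis
      using schoenberg_gamma_Suc_Suc[OF assms, of n j] schoenberg_coeff_shift[of d "Suc n" "Suc j"]
        schoenberg_coeff_shift[of d n "Suc j"] schoenberg_coeff_shift[of d "n + 2" j] 4 by metis
  qed (auto simp: schoenberg_coeff_def schoenberg_gamma_Suc_0[OF assms])
qed

lemma power_eq_sum_normalized_gegenbauer:
  assumes d: "d \<ge> 1" and x: "\<bar>x\<bar> \<le> 1"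
  shows "x ^ m = (\<Sum>n\<le>m. schoenberg_coeff d m n * normalized_gegenbauer n d x)"
proof (induction m)
  case 0
  then show ?case
    using x by (simp add: schoenberg_coeff_0[OF d])
next
  case (Suc m)
  let ?g = "schoenberg_coeff d" and ?q = "down_weight d" and ?c = "\<lambda>n. normalized_gegenbauer n d x"
  have "x ^ Suc m = (\<Sum>n\<le>m. ?g m n * (x * ?c n))"
    by (simp add: Suc sum_distrib_left mult_ac)
  also have "\<dots> = (\<Sum>n\<le>m. (1 - ?q n) * ?g m n * ?c (n + 1)) + (\<Sum>n\<le>m. ?q n * ?g m n * ?c (n - 1))"
    unfolding gegenbauer_walk[OF d x] by (simp add: algebra_simps flip: sum.distrib)
  \<comment> \<open>Two zero terms are appended so that the sum can be shifted by two; the term at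
    \<open>0\<close> drops out because \<open>down_weight d 0 = 0\<close>.\<close>
  also have "(\<Sum>n\<le>m. ?q n * ?g m n * ?c (n - 1)) = (\<Sum>n\<le>Suc (Suc m). ?q n * ?g m n * ?c (n - 1))"
    by (simp add: schoenberg_coeff_eq_0)
  also have "\<dots> = ?q 1 * ?g m 1 * ?c 0 + (\<Sum>n\<le>m. ?q (n + 2) * ?g m (n + 2) * ?c (n + 1))"
    by (simp add: sum.atMost_Suc_shift del: sum.atMost_Suc)
  also have "(\<Sum>n\<le>m. (1 - ?q n) * ?g m n * ?c (n + 1)) +
      (?q 1 * ?g m 1 * ?c 0 + (\<Sum>n\<le>m. ?q (n + 2) * ?g m (n + 2) * ?c (n + 1))) =
      (\<Sum>n\<le>Suc m. ?g (Suc m) n * ?c n)"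
    unfolding sum.atMost_Suc_shift schoenberg_coeff_Suc_0[OF d] schoenberg_coeff_Suc_Suc[OF d]
    by (simp add: distrib_right mult.assoc sum.distrib)
  finally show ?case .
qed

lemma sum_schoenberg_coeff: "d \<ge> 1 \<Longrightarrow> (\<Sum>n\<le>m. schoenberg_coeff d m n) = 1"
  using power_eq_sum_normalized_gegenbauer[of d 1 m] by (simp add: normalized_gegenbauer_at_1)

lemma schoenberg_gamma_le_1:
  assumes "d \<ge> 1"
  shows "schoenberg_gamma d n j \<le> 1"
proof -
  have "schoenberg_coeff d (n + 2 * j) n \<le> (\<Sum>k\<le>n + 2 * j. schoenberg_coeff d (n + 2 * j) k)"
    by (rule member_le_sum) (auto intro: schoenberg_coeff_nonneg assms)
  then show ?thesis
    using sum_schoenberg_coeff[OF assms, of "n + 2 * j"] by simp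
qed

text \<open>Either the partial sum is the whole expansion of \<open>x ^ m\<close>, or the missing
  part has nonnegative weights of total at most \<open>1\<close>. As the bound is free of
  \<open>x\<close>, it yields uniform convergence later.\<close>

lemma norm_power_minus_partial_sum_le:
  assumes d: "d \<ge> 1" and x: "\<bar>x\<bar> \<le> 1"
  shows "\<bar>x ^ m - (\<Sum>n<N. schoenberg_coeff d m n * normalized_gegenbauer n d x)\<bar> \<le> (if m < N then 0 else 1)"
proof (cases "m < N")
  case True
  have "(\<Sum>n<N. schoenberg_coeff d m n * normalized_gegenbauer n d x) =
      (\<Sum>n\<le>m. schoenberg_coeff d m n * normalized_gegenbauer n d x)"
    using True by (intro sum.mono_neutral_right) (auto simp: schoenberg_coeff_eq_0)
  then show ?thesis
    using True power_eq_sum_normalized_gegenbauer[OF d x, of m] by simp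
next
  case False
  have "x ^ m - (\<Sum>n<N. schoenberg_coeff d m n * normalized_gegenbauer n d x) =
      (\<Sum>n\<in>{..m} - {..<N}. schoenberg_coeff d m n * normalized_gegenbauer n d x)"
    using False unfolding power_eq_sum_normalized_gegenbauer[OF d x, of m]
    by (subst sum_diff) auto
  also have "\<bar>\<dots>\<bar> \<le> (\<Sum>n\<in>{..m} - {..<N}. schoenberg_coeff d m n * 1)"
    using abs_normalized_gegenbauer_le_1[OF d x] schoenberg_coeff_nonneg[OF d]
    by (intro order_trans[OF sum_abs] sum_mono) (auto simp: abs_mult intro!: mult_left_le)
  also have "\<dots> \<le> (\<Sum>n\<le>m. schoenberg_coeff d m n * 1)"
    using schoenberg_coeff_nonneg[OF d] by (intro sum_mono2) auto
  finally show ?thesis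
    using False by (simp add: sum_schoenberg_coeff[OF d])
qed

section \<open>Uniqueness of the coefficients\<close>

text \<open>The integral of \<open>g\<close> against the weight \<open>(1 - x\<^sup>2)\<close> to
  the power \<open>d / 2 - 1\<close>, after substituting \<open>x = cos t\<close>. For
  \<open>d = 1\<close> that weight is singular at the end points, whereas here the integrand stays
  continuous.\<close>

definition sine_moment :: "nat \<Rightarrow> (real \<Rightarrow> complex) \<Rightarrow> complex" where
  "sine_moment d g = integral {0..pi} (\<lambda>t. g (cos t) * of_real (sin t ^ (d - 1)))"

lemma continuous_on_comp_cos:
  "continuous_on {-1..1} g \<Longrightarrow> continuous_on A (\<lambda>t :: real. g (cos t))"
  by (rule continuous_on_compose2[where g = g]) (auto intro: continuous_intros)

lemma sine_moment_integrable:
  "continuous_on {-1..1} g \<Longrightarrow> (\<lambda>t. g (cos t) * complex_of_real (sin t ^ (d - 1))) integrable_on {0..pi}"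
  by (intro integrable_continuous_interval continuous_intros continuous_on_comp_cos)

lemma sine_moment_add:
  assumes "continuous_on {-1..1} g" "continuous_on {-1..1} h"
  shows "sine_moment d (\<lambda>x. g x + h x) = sine_moment d g + sine_moment d h"
  unfolding sine_moment_def using sine_moment_integrable[OF assms(1)] sine_moment_integrable[OF assms(2)]
  by (simp add: distrib_right Henstock_Kurzweil_Integration.integral_add)

lemma sine_moment_cmult: "sine_moment d (\<lambda>x. c * g x) = c * sine_moment d g"
  unfolding sine_moment_def by (simp add: mult.assoc)

lemma sine_moment_sum:
  assumes "finite A" "\<And>i. i \<in> A \<Longrightarrow> continuous_on {-1..1} (g i)"
  shows "sine_moment d (\<lambda>x. \<Sum>i\<in>A. g i x) = (\<Sum>i\<in>A. sine_moment d (g i))"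
  using assms
proof (induction A rule: finite_induct)
  case empty
  then show ?case
    by (simp add: sine_moment_def)
next
  case (insert i A)
  have "sine_moment d (\<lambda>x. \<Sum>i\<in>insert i A. g i x) = sine_moment d (\<lambda>x. g i x + (\<Sum>i\<in>A. g i x))"
    using insert by simp
  also have "\<dots> = sine_moment d (g i) + sine_moment d (\<lambda>x. \<Sum>i\<in>A. g i x)"
    using insert by (intro sine_moment_add continuous_intros) auto
  finally show ?case
    using insert by simp
qed

lemma sine_moment_cong:
  "(\<And>x. \<bar>x\<bar> \<le> 1 \<Longrightarrow> g x = h x) \<Longrightarrow> sine_moment d g = sine_moment d h"
  unfolding sine_moment_def by (intro Henstock_Kurzweil_Integration.integral_cong) auto

lemma tendsto_sine_moment:
  assumes lim: "uniform_limit {-1..1} F g sequentially"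
    and cont: "\<And>N :: nat. continuous_on {-1..1} (F N)"
  shows "(\<lambda>N. sine_moment d (F N)) \<longlonglongrightarrow> sine_moment d g"
proof -
  have "uniform_limit {0..pi} (\<lambda>N t. F N (cos t)) (\<lambda>t. g (cos t)) sequentially"
    by (rule uniform_limit_compose'[OF lim]) auto
  moreover have "bounded ((\<lambda>t. g (cos t)) ` {0..pi})"
    using uniform_limit_theorem[OF _ lim] cont
    by (intro compact_imp_bounded compact_continuous_image continuous_on_comp_cos) auto
  moreover have "bounded ((\<lambda>t. complex_of_real (sin t ^ (d - 1))) ` {0..pi})"
    by (intro compact_imp_bounded compact_continuous_image continuous_intros) auto
  ultimately have "uniform_limit {0..pi} (\<lambda>N t. F N (cos t) * complex_of_real (sin t ^ (d - 1)))
      (\<lambda>t. g (cos t) * complex_of_real (sin t ^ (d - 1))) sequentially"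
    by (intro uniform_lim_mult uniform_limit_const)
  then obtain I J where
    IJ: "\<And>N. ((\<lambda>t. F N (cos t) * complex_of_real (sin t ^ (d - 1))) has_integral I N) {0..pi}"
    "((\<lambda>t. g (cos t) * complex_of_real (sin t ^ (d - 1))) has_integral J) {0..pi}" "I \<longlonglongrightarrow> J"
    by (rule uniform_limit_integral) (auto intro!: continuous_intros continuous_on_comp_cos cont)
  have "sine_moment d (F N) = I N" for N
    unfolding sine_moment_def using IJ(1) by (rule integral_unique)
  moreover have "sine_moment d g = J"
    unfolding sine_moment_def using IJ(2) by (rule integral_unique)
  ultimately show ?thesis
    using IJ(3) by simp
qed

lemma sine_moment_of_real:
  assumes "continuous_on {-1..1} g"
  shows "sine_moment d (\<lambda>x. of_real (g x)) =
    of_real (integral {0..pi} (\<lambda>t. g (cos t) * sin t ^ (d - 1)))"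
proof -
  have "(\<lambda>t. g (cos t) * sin t ^ (d - 1)) integrable_on {0..pi}"
    by (intro integrable_continuous_interval continuous_intros continuous_on_comp_cos assms)
  then have "((\<lambda>t. complex_of_real (g (cos t) * sin t ^ (d - 1))) has_integral
      of_real (integral {0..pi} (\<lambda>t. g (cos t) * sin t ^ (d - 1)))) {0..pi}"
    by (intro has_integral_of_real integrable_integral)
  then show ?thesis
    by (simp add: sine_moment_def integral_unique)
qed

lemma sine_moment_1_neq_0: "sine_moment d (\<lambda>_. 1) \<noteq> 0"
proof
  assume "sine_moment d (\<lambda>_. 1) = 0"
  then have "integral {0..pi} (\<lambda>t. sin t ^ (d - 1)) = 0"
    using sine_moment_of_real[of "\<lambda>_. 1" d] by simp
  then have "\<forall>t\<in>{0..pi}. sin t ^ (d - 1) = 0"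
    by (subst (asm) integral_eq_0_iff) (auto intro!: continuous_intros simp: sin_ge_zero)
  then have "sin (pi / 2) ^ (d - 1) = 0"
    by (rule bspec) auto
  then show False
    by simp
qed

section \<open>Moments of powers and of the normalized polynomials\<close>

lemma sine_moment_id:
  assumes d: "d \<ge> 1"
  shows "sine_moment d (\<lambda>x. of_real x) = 0"
proof -
  have "((\<lambda>t. real d * (cos t * sin t ^ (d - 1))) has_integral sin pi ^ d - sin 0 ^ d) {0..pi}"
    by (rule fundamental_theorem_of_calculus)
      (auto simp flip: has_real_derivative_iff_has_vector_derivative intro!: derivative_eq_intros)
  from integral_unique[OF this] have "integral {0..pi} (\<lambda>t. cos t * sin t ^ (d - 1)) = 0"
    using d by simp
  then show ?thesis
    using d by (subst sine_moment_of_real) auto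
qed

text \<open>Integrate the derivative of \<open>cos t ^ (m + 1) * sin t ^ d\<close>, which vanishes
  at both ends since \<open>d \<ge> 1\<close>, and replace the square of the sine by that of the
  cosine.\<close>

lemma sine_moment_power_add_2:
  assumes d: "d \<ge> 1"
  shows "of_nat (m + 1 + d) * sine_moment d (\<lambda>x. of_real x ^ (m + 2)) =
    of_nat (m + 1) * sine_moment d (\<lambda>x. of_real x ^ m)"
proof -
  define h where "h = (\<lambda>m t. cos t ^ m * sin t ^ (d - 1) :: real)"
  have int: "h m integrable_on {0..pi}" for m
    unfolding h_def by (intro integrable_continuous_interval continuous_intros)
  have "((\<lambda>t. real (m + 1 + d) * h (m + 2) t - real (m + 1) * h m t) has_integral
      cos pi ^ (m + 1) * sin pi ^ d - cos 0 ^ (m + 1) * sin 0 ^ d) {0..pi}"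
  proof (rule fundamental_theorem_of_calculus)
    fix t :: real
    have sin2: "sin t * sin t ^ d = (1 - (cos t)\<^sup>2) * sin t ^ (d - 1)"
      using d by (cases d) (simp_all add: power2_eq_square flip: mult.assoc sin_squared_eq[unfolded power2_eq_square])
    have sin: "cos t ^ m * (sin t * sin t ^ d) = h m t - h (m + 2) t"
      unfolding sin2 by (simp add: h_def algebra_simps power2_eq_square)
    have "((\<lambda>t. cos t ^ (m + 1) * sin t ^ d) has_real_derivative
        real d * (cos t ^ (m + 1) * (cos t * sin t ^ (d - 1))) - real (m + 1) * (cos t ^ m * (sin t * sin t ^ d))) (at t)"
      by (rule DERIV_cong[OF DERIV_mult[OF DERIV_power[OF DERIV_cos, of "m + 1"] DERIV_power[OF DERIV_sin, of d]]])
        (simp add: algebra_simps)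
    also have "real d * (cos t ^ (m + 1) * (cos t * sin t ^ (d - 1))) = real d * h (m + 2) t"
      by (simp add: h_def)
    also note sin
    finally have "((\<lambda>t. cos t ^ (m + 1) * sin t ^ d) has_real_derivative
        real (m + 1 + d) * h (m + 2) t - real (m + 1) * h m t) (at t)"
      by (simp add: algebra_simps)
    then show "((\<lambda>t. cos t ^ (m + 1) * sin t ^ d) has_vector_derivative
        real (m + 1 + d) * h (m + 2) t - real (m + 1) * h m t) (at t within {0..pi})"
      by (simp add: has_real_derivative_iff_has_vector_derivative has_vector_derivative_at_within)
  qed simp
  then have "integral {0..pi} (\<lambda>t. real (m + 1 + d) * h (m + 2) t - real (m + 1) * h m t) = 0"
    using d by (simp add: integral_unique power_0_left)
  then have "real (m + 1 + d) * integral {0..pi} (h (m + 2)) = real (m + 1) * integral {0..pi} (h m)"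
    using int by (simp add: Henstock_Kurzweil_Integration.integral_diff)
  moreover have "sine_moment d (\<lambda>x. of_real x ^ m) = of_real (integral {0..pi} (h m))" for m
    using sine_moment_of_real[of "\<lambda>x. x ^ m" d] by (simp add: h_def continuous_intros)
  ultimately show ?thesis
    by (metis of_real_mult of_real_of_nat_eq)
qed

text \<open>The same ratio as between consecutive even moments in
  \<open>sine_moment_power_add_2\<close>, so that both sequences agree up to normalization.\<close>

lemma schoenberg_gamma_0_Suc_ratio:
  assumes "d \<ge> 1"
  shows "real (2 * j + 1 + d) * schoenberg_gamma d 0 (Suc j) = real (2 * j + 1) * schoenberg_gamma d 0 j"
proof (cases "d = 1")
  case True
  \<comment> \<open>Two absorption rules combine to \<open>(j + 1) A = 2 (2 j + 1) B\<close> for the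
    central binomial coefficients \<open>A\<close> and \<open>B\<close> below.\<close>
  have "Suc j * (Suc (Suc (2 * j)) choose Suc j) = Suc (Suc (2 * j)) * (Suc (2 * j) choose j)"
    by (rule Suc_times_binomial)
  moreover have "Suc j * (Suc (2 * j) choose j) = Suc (2 * j) * (2 * j choose j)"
  proof -
    have "Suc (2 * j) choose j = Suc (2 * j) choose Suc j"
      by (subst binomial_symmetric) auto
    then show ?thesis
      using Suc_times_binomial[of j "2 * j"] by simp
  qed
  ultimately have "Suc j * (Suc (Suc (2 * j)) choose Suc j) = 2 * (Suc (2 * j) * (2 * j choose j))"
    by (metis mult.assoc mult_Suc_right mult_2 mult.commute add_2_eq_Suc mult.left_commute numeral_2_eq_2)
  moreover define A B where "A = real (Suc (Suc (2 * j)) choose Suc j)" and "B = real (2 * j choose j)"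
  ultimately have AB: "real (Suc j) * A = 2 * (real (Suc (2 * j)) * B)"
    by (metis of_nat_mult of_nat_numeral)
  have g: "schoenberg_gamma 1 0 (Suc j) = A / (4 * 2 ^ (2 * j))"
    "schoenberg_gamma 1 0 j = B / 2 ^ (2 * j)"
    by (simp_all add: schoenberg_gamma_def A_def B_def)
  have A: "A = 2 * (real (Suc (2 * j)) * B) / real (Suc j)"
    using AB by (simp add: field_simps)
  show ?thesis
    unfolding True g A by (simp add: divide_simps)
next
  case False
  define \<alpha> where "\<alpha> = (real d - 1) / 2"
  note eq = schoenberg_gamma_eq[OF assms False \<alpha>_def]
  define P where "P = pochhammer \<alpha> (Suc j)"
  have pos: "P > 0" "\<alpha> + real j + 1 > 0"
    using eq(3) by (auto simp: P_def intro!: pochhammer_pos)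
  have g0: "schoenberg_gamma d 0 j = fact (2 * j) * \<alpha> / (2 ^ (2 * j) * fact j * P)"
    by (simp add: eq(1) P_def)
  have g1: "schoenberg_gamma d 0 (Suc j) =
      (2 * real j + 2) * (2 * real j + 1) * fact (2 * j) * \<alpha> /
      (4 * 2 ^ (2 * j) * ((real j + 1) * fact j) * (P * (\<alpha> + real j + 1)))"
    by (simp add: eq(1) P_def pochhammer_Suc[of _ "Suc j"] algebra_simps)
  have d: "real (2 * j + 1 + d) = 2 * (\<alpha> + real j + 1)"
    by (simp add: \<alpha>_def field_simps)
  show ?thesis
    unfolding g0 g1 d using pos by (simp add: divide_simps) (simp add: algebra_simps)
qed

lemma sine_moment_power:
  assumes d: "d \<ge> 1"
  shows "sine_moment d (\<lambda>x. of_real x ^ m) = of_real (schoenberg_coeff d m 0) * sine_moment d (\<lambda>_. 1)"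
proof -
  let ?L = "\<lambda>m. sine_moment d (\<lambda>x. of_real x ^ m)"
  have "?L (2 * j) = of_real (schoenberg_gamma d 0 j) * ?L 0" for j
  proof (induction j)
    case 0
    then show ?case
      using d by (simp add: schoenberg_gamma_0_0)
  next
    case (Suc j)
    have "of_nat (2 * j + 1 + d) * ?L (2 * Suc j) = of_nat (2 * j + 1) * (of_real (schoenberg_gamma d 0 j) * ?L 0)"
      using sine_moment_power_add_2[OF d, of "2 * j"] Suc by simp
    also have "\<dots> = of_real (real (2 * j + 1) * schoenberg_gamma d 0 j) * ?L 0"
      by simp
    also have "\<dots> = of_nat (2 * j + 1 + d) * (of_real (schoenberg_gamma d 0 (Suc j)) * ?L 0)"
      unfolding schoenberg_gamma_0_Suc_ratio[OF d, symmetric] by simp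
    finally show ?case
      using d by (simp only: mult_cancel_left of_nat_eq_0_iff) auto
  qed
  moreover have "?L (2 * j + 1) = 0" for j
  proof (induction j)
    case 0
    then show ?case
      using sine_moment_id[OF d] by simp
  next
    case (Suc j)
    then show ?case
      using sine_moment_power_add_2[OF d, of "2 * j + 1"] by (simp add: add_eq_0_iff_both_eq_0 flip: of_nat_Suc of_nat_add)
  qed
  ultimately show ?thesis
    by (cases "even m") (auto simp: schoenberg_coeff_def elim!: evenE oddE)
qed

text \<open>Apply the functional to the expansion of \<open>x ^ n\<close>. By induction only the
  terms at \<open>0\<close> and \<open>n\<close> survive, and by \<open>sine_moment_power\<close>
  the term at \<open>0\<close> already accounts for the whole moment.\<close>

lemma sine_moment_normalized_gegenbauer:
  assumes d: "d \<ge> 1" and n: "n \<ge> 1"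
  shows "sine_moment d (\<lambda>x. of_real (normalized_gegenbauer n d x)) = 0"
  using n
proof (induction n rule: less_induct)
  case (less n)
  let ?L = "\<lambda>n. sine_moment d (\<lambda>x. of_real (normalized_gegenbauer n d x))"
  have "sine_moment d (\<lambda>x. of_real x ^ n) =
      sine_moment d (\<lambda>x. \<Sum>k\<le>n. of_real (schoenberg_coeff d n k) * of_real (normalized_gegenbauer k d x))"
    using power_eq_sum_normalized_gegenbauer[OF d, of _ n]
    by (intro sine_moment_cong) (simp flip: of_real_power)
  also have "\<dots> = (\<Sum>k\<le>n. of_real (schoenberg_coeff d n k) * ?L k)"
    by (subst sine_moment_sum) (auto intro!: continuous_intros continuous_on_normalized_gegenbauer d simp: sine_moment_cmult)
  also have "\<dots> = (\<Sum>k\<in>{0, n}. of_real (schoenberg_coeff d n k) * ?L k)"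
    using less.IH by (intro sum.mono_neutral_right) auto
  also have "\<dots> = of_real (schoenberg_coeff d n 0) * ?L 0 + of_real (schoenberg_coeff d n n) * ?L n"
    using less.prems by simp
  also have "?L 0 = sine_moment d (\<lambda>_. 1)"
    by (rule sine_moment_cong) simp
  finally have "complex_of_real (schoenberg_coeff d n n) * ?L n = 0"
    using sine_moment_power[OF d, of n] by simp
  \<comment> \<open>This is the probability that the first \<open>n\<close> steps all go up, a
    product of positive weights.\<close>
  moreover have "schoenberg_coeff d n n \<noteq> 0"
  proof (induction n)
    case (Suc n)
    then show ?case
      using down_weight_less_1[OF d, of n]
      by (simp add: schoenberg_coeff_Suc_Suc[OF d] schoenberg_coeff_eq_0)
  qed (simp add: schoenberg_coeff_0[OF d])
  ultimately show ?case
    by simp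
qed

text \<open>Each factor \<open>x\<close> moves the index by one, so \<open>x ^ m\<close> cannot
  bring an index \<open>n > m\<close> down to \<open>0\<close>. For \<open>n = m\<close> exactly one
  path does, and its \<open>down_weight\<close> factors are positive.\<close>

lemma sine_moment_power_gegenbauer:
  assumes d: "d \<ge> 1"
  defines "L \<equiv> \<lambda>m n. sine_moment d (\<lambda>x. of_real x ^ m * of_real (normalized_gegenbauer n d x))"
  shows "n > m \<Longrightarrow> L m n = 0" and "L m m \<noteq> 0"
proof (induction m arbitrary: n)
  case 0
  {
    case 1
    then show ?case
      using sine_moment_normalized_gegenbauer[OF d, of n] by (simp add: L_def)
  next
    case 2
    have "L 0 0 = sine_moment d (\<lambda>_. 1)"
      unfolding L_def by (rule sine_moment_cong) simp
    then show ?case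
      by (simp add: sine_moment_1_neq_0)
  }
next
  case (Suc m)
  have step: "L (Suc m) n = of_real (1 - down_weight d n) * L m (n + 1) + of_real (down_weight d n) * L m (n - 1)" for n
  proof -
    have "L (Suc m) n = sine_moment d (\<lambda>x.
        of_real (1 - down_weight d n) * (of_real x ^ m * of_real (normalized_gegenbauer (n + 1) d x)) +
        of_real (down_weight d n) * (of_real x ^ m * of_real (normalized_gegenbauer (n - 1) d x)))"
      unfolding L_def
    proof (rule sine_moment_cong)
      fix x :: real assume x: "\<bar>x\<bar> \<le> 1"
      have "complex_of_real x ^ Suc m * of_real (normalized_gegenbauer n d x) =
          of_real x ^ m * of_real (x * normalized_gegenbauer n d x)"
        by simp
      also have "\<dots> = of_real x ^ m * of_real ((1 - down_weight d n) * normalized_gegenbauer (n + 1) d x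
          + down_weight d n * normalized_gegenbauer (n - 1) d x)"
        by (simp only: gegenbauer_walk[OF d x])
      finally show "complex_of_real x ^ Suc m * of_real (normalized_gegenbauer n d x) =
          of_real (1 - down_weight d n) * (of_real x ^ m * of_real (normalized_gegenbauer (n + 1) d x)) +
          of_real (down_weight d n) * (of_real x ^ m * of_real (normalized_gegenbauer (n - 1) d x))"
        by (simp add: algebra_simps)
    qed
    also have "\<dots> = of_real (1 - down_weight d n) * L m (n + 1) + of_real (down_weight d n) * L m (n - 1)"
      unfolding L_def
      by (subst sine_moment_add)
        (auto intro!: continuous_intros continuous_on_normalized_gegenbauer d simp: sine_moment_cmult)
    finally show ?thesis .
  qed
  {
    case 1
    then show ?case
      by (simp add: step Suc.IH(1))
  next
    case 2
    then show ?case
      using down_weight_pos[OF d, of "Suc m"] Suc.IH by (simp add: step)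
  }
qed

text \<open>Multiplying by \<open>x ^ m\<close> and applying the functional kills the terms above
  \<open>m\<close>; those below vanish by induction. So the moments of the partial sums are
  eventually constant, equal to \<open>a m\<close> times a nonzero number, and tend to
  \<open>0\<close>.\<close>

lemma normalized_gegenbauer_series_unique:
  fixes a :: "nat \<Rightarrow> complex"
  assumes d: "d \<ge> 1"
    and lim: "uniform_limit {-1..1} (\<lambda>N x. \<Sum>n<N. a n * of_real (normalized_gegenbauer n d x)) (\<lambda>_. 0) sequentially"
  shows "a n = 0"
proof (induction n rule: less_induct)
  case (less m)
  define L where "L = (\<lambda>n. sine_moment d (\<lambda>x. of_real x ^ m * of_real (normalized_gegenbauer n d x)))"
  define F where "F = (\<lambda>N x. of_real x ^ m * (\<Sum>n<N. a n * of_real (normalized_gegenbauer n d x)))"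
  have "uniform_limit {-1..1} F (\<lambda>x. of_real x ^ m * 0) sequentially"
    unfolding F_def
    by (intro uniform_lim_mult uniform_limit_const lim compact_imp_bounded compact_continuous_image continuous_intros)
      auto
  then have "(\<lambda>N. sine_moment d (F N)) \<longlonglongrightarrow> sine_moment d (\<lambda>x. of_real x ^ m * 0)"
    by (rule tendsto_sine_moment)
      (auto simp: F_def intro!: continuous_intros continuous_on_normalized_gegenbauer d)
  then have lim0: "(\<lambda>N. sine_moment d (F N)) \<longlonglongrightarrow> 0"
    by (simp add: sine_moment_def)
  have FN: "sine_moment d (F N) = a m * L m" if "N > m" for N
  proof -
    have "F N = (\<lambda>x. \<Sum>n<N. a n * (of_real x ^ m * of_real (normalized_gegenbauer n d x)))"
      by (simp add: F_def sum_distrib_left mult_ac)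
    then have "sine_moment d (F N) = (\<Sum>n<N. a n * L n)"
      unfolding L_def
      by (simp only:) (subst sine_moment_sum,
        auto intro!: continuous_intros continuous_on_normalized_gegenbauer d simp: sine_moment_cmult)
    also have "\<dots> = (\<Sum>n\<in>{m}. a n * L n)"
      using that less.IH sine_moment_power_gegenbauer(1)[OF d, of m]
      by (intro sum.mono_neutral_right) (auto simp: L_def neq_iff)
    finally show ?thesis
      by simp
  qed
  have "(\<lambda>_ :: nat. a m * L m) \<longlonglongrightarrow> 0"
    by (rule Lim_transform_eventually[OF lim0])
      (use FN in \<open>auto intro!: eventually_sequentiallyI[of "Suc m"]\<close>)
  then have "a m * L m = 0"
    by (simp add: tendsto_const_iff LIMSEQ_const_iff)
  then show ?case
    using sine_moment_power_gegenbauer(2)[OF d, of m] by (simp add: L_def)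
qed

section \<open>Positive definite functions\<close>

text \<open>Everything follows from evaluating the quadratic form at vectors
  \<open>(1, s)\<close>.\<close>

lemma pos_semidef_2_norm_le:
  assumes "pos_semidef 2 A" and diag: "A 0 0 = A 1 1"
  shows "norm (A 0 1) \<le> Re (A 0 0)"
proof -
  have form: "A 0 0 + A 0 1 * cnj s + (A 1 0 * s + A 1 1 * (s * cnj s)) \<in> \<real>\<^sub>\<ge>\<^sub>0" for s
    using assms(1)[unfolded pos_semidef_def, rule_format, of "\<lambda>k. if k = 0 then 1 else s"]
    by (simp add: numeral_2_eq_2 mult.assoc)
  have nonneg: "Re z \<ge> 0" "Im z = 0" if "z \<in> \<real>\<^sub>\<ge>\<^sub>0" for z
    using that by (auto simp: complex_nonneg_Reals_iff)
  have "Im (A 0 0) = 0"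
    using nonneg(2)[OF form[of 0]] by simp
  \<comment> \<open>The imaginary parts at \<open>s = 1\<close> and \<open>s = \<i>\<close> give the
    sum and the difference relation between the two off-diagonal entries.\<close>
  then have herm: "A 1 0 = cnj (A 0 1)"
    using nonneg(2)[OF form[of 1]] nonneg(2)[OF form[of \<i>]] diag
    by (simp add: complex_eq_iff)
  show ?thesis
  proof (cases "A 0 1 = 0")
    case True
    then show ?thesis
      using nonneg(1)[OF form[of 0]] by simp
  next
    case False
    \<comment> \<open>This unit vector turns both cross terms into \<open>- norm (A 0 1)\<close>, so
      the form equals \<open>2 * (A 0 0 - norm (A 0 1))\<close>.\<close>
    define s where "s = - sgn (A 0 1)"
    have s: "s * cnj s = 1" "A 0 1 * cnj s = - of_real (norm (A 0 1))"
      "cnj (A 0 1) * s = - of_real (norm (A 0 1))"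
    proof -
      show "s * cnj s = 1"
        using False by (simp add: s_def norm_sgn flip: complex_norm_square)
      have *: "A 0 1 * cnj (sgn (A 0 1)) = of_real (norm (A 0 1))"
        using False complex_norm_square[of "A 0 1"]
        by (simp add: sgn_div_norm scaleR_conv_of_real field_simps power2_eq_square)
      then show "A 0 1 * cnj s = - of_real (norm (A 0 1))"
        by (simp add: s_def)
      show "cnj (A 0 1) * s = - of_real (norm (A 0 1))"
        using arg_cong[OF *, of cnj] by (simp add: s_def)
    qed
    have "0 \<le> Re (A 0 0 + A 0 1 * cnj s + (A 1 0 * s + A 1 1 * (s * cnj s)))"
      by (rule nonneg(1)[OF form])
    then show ?thesis
      unfolding herm s diag[symmetric] by simp
  qed
qed

text \<open>The matrix for the two points \<open>0\<close> and \<open>u\<close> has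
  \<open>\<phi> 0\<close> on its diagonal and \<open>\<phi> u\<close> beside it.\<close>

lemma norm_pos_def_funs_le:
  fixes \<phi> :: "'g :: topological_group_add \<Rightarrow> complex"
  assumes "\<phi> \<in> pos_def_funs"
  shows "norm (\<phi> u) \<le> Re (\<phi> 0)"
proof -
  define v where "v = (\<lambda>k :: nat. if k = 0 then 0 else u)"
  have "pos_semidef 2 (\<lambda>k l. \<phi> (- v k + v l))"
    using assms by (auto simp: pos_def_funs_def)
  from pos_semidef_2_norm_le[OF this] show ?thesis
    by (simp add: v_def)
qed

lemma pos_semidef_sums:
  assumes A: "\<And>j. pos_semidef n (A j)" and c: "\<And>j. c j \<ge> 0"
    and sums: "\<And>k l. (\<lambda>j. A j k l * of_real (c j)) sums B k l"
  shows "pos_semidef n B"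
  unfolding pos_semidef_def
proof
  fix a :: "nat \<Rightarrow> complex"
  let ?Q = "\<lambda>A. \<Sum>k<n. \<Sum>l<n. A k l * a k * cnj (a l)"
  have "(\<lambda>j. \<Sum>k<n. \<Sum>l<n. A j k l * of_real (c j) * (a k * cnj (a l))) sums
      (\<Sum>k<n. \<Sum>l<n. B k l * (a k * cnj (a l)))"
    by (intro sums_sum sums_mult2 sums)
  then have "(\<lambda>j. of_real (c j) * ?Q (A j)) sums ?Q B"
    by (simp add: sum_distrib_left mult_ac)
  then have lim: "(\<lambda>N. \<Sum>j<N. of_real (c j) * ?Q (A j)) \<longlonglongrightarrow> ?Q B"
    by (simp add: sums_def)
  have "of_real (c j) * ?Q (A j) \<in> \<real>\<^sub>\<ge>\<^sub>0" for j
    using A c by (intro nonneg_Reals_mult_I) (auto simp: pos_semidef_def)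
  then have "(\<Sum>j<N. of_real (c j) * ?Q (A j)) \<in> \<real>\<^sub>\<ge>\<^sub>0" for N
    by (induction N) (auto intro: nonneg_Reals_add_I)
  then show "?Q B \<in> \<real>\<^sub>\<ge>\<^sub>0"
    by (rule closed_sequentially[OF closed_nonneg_Reals_complex _ lim])
qed

text \<open>Continuity passes to the uniform limit, semidefiniteness already to the pointwise one,
  because the nonnegative reals are closed in the complex numbers.\<close>

lemma pos_def_funs_sums:
  assumes \<phi>: "\<And>j. \<phi> j \<in> pos_def_funs" and c: "\<And>j. c j \<ge> 0"
    and lim: "uniform_limit UNIV (\<lambda>N u. \<Sum>j<N. \<phi> j u * of_real (c j)) \<psi> sequentially"
  shows "\<psi> \<in> pos_def_funs"
proof -
  have "continuous_on UNIV (\<lambda>u. \<Sum>j<N. \<phi> j u * of_real (c j))" for N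
    using \<phi> by (intro continuous_intros) (auto simp: pos_def_funs_def)
  then have "continuous_on UNIV \<psi>"
    by (intro uniform_limit_theorem[OF _ lim]) auto
  moreover have "pos_semidef n (\<lambda>k l. \<psi> (- u k + u l))" if "n \<ge> 1" for n u
  proof (rule pos_semidef_sums)
    show "pos_semidef n (\<lambda>k l. \<phi> j (- u k + u l))" for j
      using \<phi>[of j] that by (simp add: pos_def_funs_def)
    show "(\<lambda>j. \<phi> j (- u k + u l) * of_real (c j)) sums \<psi> (- u k + u l)" for k l
      unfolding sums_def by (rule tendsto_uniform_limitI[OF lim]) simp
  qed (rule c)
  ultimately show ?thesis
    by (simp add: pos_def_funs_def)
qed

text \<open>For each fixed \<open>u\<close> the difference of two representations is a null series
  in \<open>x\<close> alone. This justifies the definite description in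
  \<open>schoenberg_functions\<close>.\<close>

lemma schoenberg_representation_unique:
  assumes d: "d \<ge> 1" and "schoenberg_representation d f \<psi>" "schoenberg_representation d f \<psi>'"
  shows "\<psi> = \<psi>'"
proof (intro ext)
  fix n u
  have lim: "uniform_limit {-1..1} (\<lambda>N x. \<Sum>n<N. \<psi> n u * of_real (normalized_gegenbauer n d x))
      (\<lambda>x. f (x, u)) sequentially" if "schoenberg_representation d f \<psi>" for \<psi>
  proof -
    have "uniform_limit ({-1..1} \<times> UNIV)
       (\<lambda>N (x, u). \<Sum>n<N. \<psi> n u * of_real (normalized_gegenbauer n d x)) f sequentially"
      using that by (simp add: schoenberg_representation_def)
    from uniform_limit_compose'[OF this, where B = "{-1..1}" and h = "\<lambda>x. (x, u)"] show ?thesis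
      by auto
  qed
  have "uniform_limit {-1..1} (\<lambda>N x. \<Sum>n<N. (\<psi> n u - \<psi>' n u) * of_real (normalized_gegenbauer n d x))
      (\<lambda>_. 0) sequentially"
    using uniform_limit_minus[OF lim[OF assms(2)] lim[OF assms(3)]]
    by (simp add: left_diff_distrib flip: sum_subtractf)
  from normalized_gegenbauer_series_unique[OF d this] show "\<psi> n u = \<psi>' n u"
    by simp
qed

section \<open>Convergence of the rearranged series\<close>

text \<open>Since the coefficients are probabilities, the values
  \<open>Re (\<phi> (n + 2 * j) 0)\<close> form a majorant, and they are a subseries of a convergent
  series of nonnegative terms.\<close>

lemma uniform_limit_schoenberg_series:
  assumes \<phi>: "\<And>n. \<phi> n \<in> pos_def_funs" and sum: "summable (\<lambda>n. \<phi> n 0)" and d: "d \<ge> 1"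
  shows "uniform_limit UNIV (\<lambda>N u. \<Sum>j<N. \<phi> (n + 2 * j) u * of_real (schoenberg_gamma d n j))
      (\<lambda>u. \<Sum>j. \<phi> (n + 2 * j) u * of_real (schoenberg_gamma d n j)) sequentially"
proof (rule Weierstrass_m_test)
  have "norm (\<phi> (n + 2 * j) u) * schoenberg_gamma d n j \<le> Re (\<phi> (n + 2 * j) 0) * 1" for j u
    using norm_pos_def_funs_le[OF \<phi>] schoenberg_gamma_nonneg[OF d] schoenberg_gamma_le_1[OF d]
    by (intro mult_mono) (auto intro: order_trans[OF norm_ge_zero])
  then show "norm (\<phi> (n + 2 * j) u * of_real (schoenberg_gamma d n j)) \<le> Re (\<phi> (n + 2 * j) 0)" for j u
    using schoenberg_gamma_nonneg[OF d] by (simp add: norm_mult)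
  have nonneg: "Re (\<phi> n 0) \<ge> 0" for n
    using norm_pos_def_funs_le[OF \<phi>] order_trans[OF norm_ge_zero] by blast
  have "summable (\<lambda>n. Re (\<phi> n 0))"
    using sum by (rule summable_Re)
  then have "summable ((\<lambda>n. Re (\<phi> n 0)) \<circ> (\<lambda>j. n + 2 * j))"
    by (rule summable_reindex) (auto intro: injI nonneg)
  then show "summable (\<lambda>j. Re (\<phi> (n + 2 * j) 0))"
    by (simp add: o_def)
qed

text \<open>Only the finite sum over \<open>n < N\<close> is exchanged with a series. Collected by
  \<open>m\<close>, the error has terms \<open>\<phi> m u\<close> times the remainder of
  \<open>x ^ m\<close>, which \<open>norm_power_minus_partial_sum_le\<close> controls.\<close>

lemma norm_minus_schoenberg_partial_sum_le:
  assumes \<phi>: "\<And>n. \<phi> n \<in> pos_def_funs" and sum: "summable (\<lambda>n. \<phi> n 0)" and d: "d \<ge> 1"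
    and f: "(\<lambda>n. \<phi> n u * of_real (x ^ n)) sums f" and x: "\<bar>x\<bar> \<le> 1"
    and \<psi>: "\<And>n. (\<lambda>j. \<phi> (n + 2 * j) u * of_real (schoenberg_gamma d n j)) sums \<psi> n"
  shows "norm (f - (\<Sum>n<N. \<psi> n * of_real (normalized_gegenbauer n d x))) \<le> (\<Sum>m. Re (\<phi> (m + N) 0))"
proof -
  \<comment> \<open>The series over \<open>j\<close> is spread out over all \<open>m\<close>, with
    zeros in between, so that it runs over the same index as the power series.\<close>
  have "(\<lambda>m. \<phi> m u * of_real (schoenberg_coeff d m n)) sums \<psi> n" for n
  proof -
    have "strict_mono (\<lambda>j. n + 2 * j)"
      by (rule strict_monoI) simp
    moreover have "\<phi> m u * of_real (schoenberg_coeff d m n) = 0" if "m \<notin> range (\<lambda>j. n + 2 * j)" for m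
    proof -
      have "\<not> (n \<le> m \<and> even (m - n))"
        using that by (metis evenE le_add_diff_inverse rangeI)
      then show ?thesis
        by (auto simp: schoenberg_coeff_def)
    qed
    ultimately have "(\<lambda>j. \<phi> (n + 2 * j) u * of_real (schoenberg_coeff d (n + 2 * j) n)) sums \<psi> n \<longleftrightarrow>
        (\<lambda>m. \<phi> m u * of_real (schoenberg_coeff d m n)) sums \<psi> n"
      by (rule sums_mono_reindex)
    then show ?thesis
      using \<psi> by simp
  qed
  then have "(\<lambda>m. \<phi> m u * of_real (x ^ m) - (\<Sum>n<N. \<phi> m u * of_real (schoenberg_coeff d m n) *
        of_real (normalized_gegenbauer n d x))) sums
      (f - (\<Sum>n<N. \<psi> n * of_real (normalized_gegenbauer n d x)))"
    by (intro sums_diff f sums_sum sums_mult2)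
  also have "(\<lambda>m. \<phi> m u * of_real (x ^ m) - (\<Sum>n<N. \<phi> m u * of_real (schoenberg_coeff d m n) *
        of_real (normalized_gegenbauer n d x))) =
      (\<lambda>m. \<phi> m u * of_real (x ^ m - (\<Sum>n<N. schoenberg_coeff d m n * normalized_gegenbauer n d x)))"
    by (simp add: right_diff_distrib sum_distrib_left mult.assoc)
  finally have sums: "(\<lambda>m. \<phi> m u * of_real (x ^ m - (\<Sum>n<N. schoenberg_coeff d m n * normalized_gegenbauer n d x)))
      sums (f - (\<Sum>n<N. \<psi> n * of_real (normalized_gegenbauer n d x)))" (is "?t sums ?s") .
  have bound: "norm (?t m) \<le> (if m < N then 0 else Re (\<phi> m 0))" for m
  proof -
    have "norm (?t m) \<le> Re (\<phi> m 0) * (if m < N then 0 else 1)"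
      unfolding norm_mult norm_of_real
      using norm_pos_def_funs_le[OF \<phi>, of m u] norm_power_minus_partial_sum_le[OF d x, of m N]
      by (intro mult_mono) (auto intro: order_trans[OF norm_ge_zero])
    then show ?thesis
      by (simp split: if_splits)
  qed
  \<comment> \<open>Powers below \<open>N\<close> are expanded completely, so the error series
    starts at \<open>N\<close>.\<close>
  have zero: "?t m = 0" if "m < N" for m
    using bound[of m] that by (simp only: if_True) simp
  have "(\<Sum>i<N. ?t i) = 0"
    by (rule sum.neutral) (auto intro: zero simp only: lessThan_iff)
  then have sums': "(\<lambda>m. ?t (m + N)) sums ?s"
    using sums_split_initial_segment[OF sums, of N] by simp
  have "summable (\<lambda>m. Re (\<phi> (m + N) 0))"
    using summable_ignore_initial_segment[OF summable_Re[OF sum]] .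
  moreover have "norm (?t (m + N)) \<le> Re (\<phi> (m + N) 0)" for m
    using bound[of "m + N"] by simp
  ultimately have "norm (suminf (\<lambda>m. ?t (m + N))) \<le> (\<Sum>m. Re (\<phi> (m + N) 0))"
    by (intro norm_suminf_le)
  then show ?thesis
    using sums_unique[OF sums'] by simp
qed

theorem theorem5p4:
  fixes f :: "real \<times> 'g :: {topological_group_add, t2_space} \<Rightarrow> complex"
    and \<phi> :: "nat \<Rightarrow> 'g \<Rightarrow> complex"
    and d :: nat
  assumes "locally_compact_space (euclidean :: 'g topology)"
    and "f \<in> sphere_infinity_pos_def_funs"
    and "\<And>n. \<phi> n \<in> pos_def_funs"
    and "summable (\<lambda>n. \<phi> n 0)"
    and "\<And>x u. x \<in> {-1..1} \<Longrightarrow> (\<lambda>n. \<phi> n u * of_real (x ^ n)) sums f (x, u)"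
    and "d \<ge> 1"
  shows "schoenberg_representation d f (schoenberg_functions d f) \<and>
    (\<forall>n. (\<forall>u. (\<lambda>j. \<phi> (n + 2 * j) u * of_real (schoenberg_gamma d n j))
                sums schoenberg_functions d f n u) \<and>
         uniformly_convergent_on UNIV
           (\<lambda>N u. \<Sum>j<N. \<phi> (n + 2 * j) u * of_real (schoenberg_gamma d n j)))"
proof -
  note \<phi> = assms(3) and summable = assms(4) and f = assms(5) and d = assms(6)
  define \<psi> where "\<psi> = (\<lambda>n u. \<Sum>j. \<phi> (n + 2 * j) u * of_real (schoenberg_gamma d n j))"
  have lim: "uniform_limit UNIV (\<lambda>N u. \<Sum>j<N. \<phi> (n + 2 * j) u * of_real (schoenberg_gamma d n j)) (\<psi> n) sequentially"
    for n
    unfolding \<psi>_def by (rule uniform_limit_schoenberg_series[OF \<phi> summable d])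
  then have sums: "(\<lambda>j. \<phi> (n + 2 * j) u * of_real (schoenberg_gamma d n j)) sums \<psi> n u" for n u
    unfolding sums_def by (rule tendsto_uniform_limitI) simp
  have series: "uniform_limit ({-1..1} \<times> UNIV)
      (\<lambda>N (x, u). \<Sum>n<N. \<psi> n u * of_real (normalized_gegenbauer n d x)) f sequentially"
  proof (rule uniform_limitI)
    fix e :: real assume "e > 0"
    \<comment> \<open>Tails of a convergent series; they bound the error for all \<open>x\<close>
      and \<open>u\<close> at once.\<close>
    have "(\<lambda>N. \<Sum>m. Re (\<phi> (m + N) 0)) \<longlonglongrightarrow> 0"
      by (rule suminf_exist_split2) (rule summable_Re[OF summable])
    then have "\<forall>\<^sub>F N in sequentially. (\<Sum>m. Re (\<phi> (m + N) 0)) < e"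
      using \<open>e > 0\<close> by (rule order_tendstoD)
    then show "\<forall>\<^sub>F N in sequentially. \<forall>y\<in>{-1..1} \<times> UNIV.
        dist (case y of (x, u) \<Rightarrow> \<Sum>n<N. \<psi> n u * of_real (normalized_gegenbauer n d x)) (f y) < e"
    proof eventually_elim
      case (elim N)
      have "norm (f (x, u) - (\<Sum>n<N. \<psi> n u * of_real (normalized_gegenbauer n d x))) < e"
        if "x \<in> {-1..1}" for x u
      proof -
        have "\<bar>x\<bar> \<le> 1"
          using that by auto
        from norm_minus_schoenberg_partial_sum_le[OF \<phi> summable d f[OF that] this sums, of u N]
        show ?thesis
          using elim by simp
      qed
      then show ?case
        by (auto simp: dist_norm norm_minus_commute)
    qed
  qed
  have "\<psi> n \<in> pos_def_funs" for n
    by (rule pos_def_funs_sums[OF \<phi> schoenberg_gamma_nonneg[OF d] lim])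
  \<comment> \<open>At the point \<open>(1, 0)\<close> every normalized polynomial is
    \<open>1\<close>, so the partial sums of \<open>\<psi> n 0\<close> converge to
    \<open>f (1, 0)\<close>.\<close>
  moreover have "summable (\<lambda>n. \<psi> n 0)"
    using tendsto_uniform_limitI[OF series, of "(1, 0)"]
    by (auto simp: normalized_gegenbauer_at_1[OF d] summable_def sums_def)
  ultimately have rep: "schoenberg_representation d f \<psi>"
    using series by (simp add: schoenberg_representation_def)
  have "schoenberg_functions d f = \<psi>"
    unfolding schoenberg_functions_def
    by (rule the_equality[where P = "schoenberg_representation d f", OF rep])
      (rule schoenberg_representation_unique[OF d _ rep])
  with rep sums lim show ?thesis
    by (auto simp: uniformly_convergent_on_def)
qed

end
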